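(* For every $q\in(0,1)$ and every $\eta>0$, there are an integer $m$ and $m$ all-null scores $W_1,\ldots,W_m$ with the following properties: (1) the vector $(W_1,\ldots,W_m)$ is exchangeable and has a strictly positive joint density on $\mathbb R^m$; (2) all coordinates have the same continuous distribution, symmetric about zero; (3) $\operatorname{Cov}(W_i,W_j)=0$ for every $i\ne j$; (4) the knockoff+ threshold at nominal level $q$ has $\mathrm{FDR}>1-\eta$. Moreover, if $F$ is the common marginal distribution function and $P_i=1-F(W_i)$, then the $P_i$ are exchangeable and exactly uniform on $(0,1)$, their joint density is positive on $(0,1)^m$, and the mirror threshold at level $q$ applied to $P_1,\ldots,P_m$ has the same FDR.
   Context: "All-null" means that every hypothesis is a true null, i.e. $\mathcal H_0=\{1,\ldots,m\}$. For signed scores $W_1,\ldots,W_m$ and $t>0$, put $N_+(t)=\#\{i:W_i\ge t\}$, $N_-(t)=\#\{i:W_i\le -t\}$, and $\mathcal T=\{|W_i|:|W_i|>0\}$. The knockoff+ threshold at level $q$ is $$\widehat t=\min\Big\{t\in\mathcal T:\frac{1+N_-(t)}{N_+(t)\vee1}\le q\Big\},$$ with $\widehat t=\infty$ if the set is empty, and the rejection set is $\widehat{\mathcal R}=\{i:W_i\ge\widehat t\}$. For $p$-values $P_1,\ldots,P_m$ and $0<u\le1/2$, put $R(u)=\#\{i:P_i\le u\}$, $L(u)=\#\{i:P_i\ge1-u\}$, $\mathcal U=\{\min(P_i,1-P_i):1\le i\le m\}\cap(0,1/2]$; the mirror threshold at level $q$ is $\widehat u=\max\{u\in\mathcal U:(1+L(u))/(R(u)\vee1)\le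 q\}$, with $\widehat u=0$ if the set is empty, and it rejects $\{i:P_i\le\widehat u\}$. Here $a\vee b=\max\{a,b\}$. For a rejection set $\widehat{\mathcal R}$, $\mathrm{FDR}=\mathbb E\{|\widehat{\mathcal R}\cap\mathcal H_0|/(|\widehat{\mathcal R}|\vee1)\}$. *)

theory Defs
  imports "HOL-Probability.Probability" "HOL-Combinatorics.Permutations"
begin

section \<open>Signed scores and the knockoff+ threshold\<close>

text \<open>Hypotheses are indexed by a finite set \<open>I\<close>.\<close>

definition N_plus :: "'i set \<Rightarrow> ('i \<Rightarrow> real) \<Rightarrow> real \<Rightarrow> nat" where
  "N_plus I w t = card {i \<in> I. w i \<ge> t}"

definition N_minus :: "'i set \<Rightarrow> ('i \<Rightarrow> real) \<Rightarrow> real \<Rightarrow> nat" where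
  "N_minus I w t = card {i \<in> I. w i \<le> - t}"

definition score_grid :: "'i set \<Rightarrow> ('i \<Rightarrow> real) \<Rightarrow> real set" where
  "score_grid I w = {\<bar>w i\<bar> | i. i \<in> I \<and> \<bar>w i\<bar> > 0}"

definition knockoff_admissible :: "real \<Rightarrow> 'i set \<Rightarrow> ('i \<Rightarrow> real) \<Rightarrow> real set" where
  "knockoff_admissible q I w =
     {t \<in> score_grid I w. (1 + real (N_minus I w t)) / real (max (N_plus I w t) 1) \<le> q}"

definition knockoff_threshold :: "real \<Rightarrow> 'i set \<Rightarrow> ('i \<Rightarrow> real) \<Rightarrow> ereal" where
  "knockoff_threshold q I w =
     (if knockoff_admissible q I w = {} then \<infinity> else ereal (Min (knockoff_admissible q I w)))"

definition knockoff_rejections :: "real \<Rightarrow> 'i set \<Rightarrow> ('i \<Rightarrow> real) \<Rightarrow> 'i set" where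
  "knockoff_rejections q I w = {i \<in> I. ereal (w i) \<ge> knockoff_threshold q I w}"


section \<open>p-values and the mirror threshold\<close>

definition R_count :: "'i set \<Rightarrow> ('i \<Rightarrow> real) \<Rightarrow> real \<Rightarrow> nat" where
  "R_count I p u = card {i \<in> I. p i \<le> u}"

definition L_count :: "'i set \<Rightarrow> ('i \<Rightarrow> real) \<Rightarrow> real \<Rightarrow> nat" where
  "L_count I p u = card {i \<in> I. p i \<ge> 1 - u}"

definition mirror_grid :: "'i set \<Rightarrow> ('i \<Rightarrow> real) \<Rightarrow> real set" where
  "mirror_grid I p = {min (p i) (1 - p i) | i. i \<in> I} \<inter> {0<..1/2}"

definition mirror_admissible :: "real \<Rightarrow> 'i set \<Rightarrow> ('i \<Rightarrow> real) \<Rightarrow> real set" where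
  "mirror_admissible q I p =
     {u \<in> mirror_grid I p. (1 + real (L_count I p u)) / real (max (R_count I p u) 1) \<le> q}"

definition mirror_threshold :: "real \<Rightarrow> 'i set \<Rightarrow> ('i \<Rightarrow> real) \<Rightarrow> real" where
  "mirror_threshold q I p =
     (if mirror_admissible q I p = {} then 0 else Max (mirror_admissible q I p))"

definition mirror_rejections :: "real \<Rightarrow> 'i set \<Rightarrow> ('i \<Rightarrow> real) \<Rightarrow> 'i set" where
  "mirror_rejections q I p = {i \<in> I. p i \<le> mirror_threshold q I p}"


section \<open>False discovery rate and distributional notions\<close>

text \<open>Here \<open>H0\<close> is the set of true nulls and \<open>Rej\<close> the random rejection set.\<close>

definition FDR :: "'a measure \<Rightarrow> 'i set \<Rightarrow> ('a \<Rightarrow> 'i set) \<Rightarrow> real" where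
  "FDR M H0 Rej = (\<integral>\<omega>. real (card (Rej \<omega> \<inter> H0)) / real (max (card (Rej \<omega>)) 1) \<partial>M)"

definition exchangeable :: "'a measure \<Rightarrow> 'i set \<Rightarrow> ('i \<Rightarrow> 'a \<Rightarrow> real) \<Rightarrow> bool" where
  "exchangeable M I X \<longleftrightarrow>
     (\<forall>\<pi>. \<pi> permutes I \<longrightarrow>
        distr M (\<Pi>\<^sub>M i\<in>I. borel) (\<lambda>\<omega>. \<lambda>i\<in>I. X (\<pi> i) \<omega>) =
        distr M (\<Pi>\<^sub>M i\<in>I. borel) (\<lambda>\<omega>. \<lambda>i\<in>I. X i \<omega>))"

text \<open>
  The joint law of \<open>(X i)\<close> for \<open>i \<in> I\<close> has a Lebesgue density that is finite, nonnegative, and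
  strictly positive at every point of \<open>A\<close>. Vectors indexed by \<open>I\<close> are the functions in
  \<open>\<Pi>\<^sub>E i\<in>I. UNIV\<close>, the carrier of the product measure.
\<close>

definition has_joint_density_pos_on ::
  "'a measure \<Rightarrow> 'i set \<Rightarrow> ('i \<Rightarrow> 'a \<Rightarrow> real) \<Rightarrow> ('i \<Rightarrow> real) set \<Rightarrow> bool" where
  "has_joint_density_pos_on M I X A \<longleftrightarrow>
     (\<exists>f :: ('i \<Rightarrow> real) \<Rightarrow> real.
        distributed M (\<Pi>\<^sub>M i\<in>I. lborel) (\<lambda>\<omega>. \<lambda>i\<in>I. X i \<omega>) (\<lambda>x. ennreal (f x)) \<and>
        (\<forall>x. 0 \<le> f x) \<and> (\<forall>x\<in>A. 0 < f x))"

text \<open>Meaningful only for square-integrable arguments, since non-integrable functions integrate to 0.\<close>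

definition covariance :: "'a measure \<Rightarrow> ('a \<Rightarrow> real) \<Rightarrow> ('a \<Rightarrow> real) \<Rightarrow> real" where
  "covariance M X Y =
     (\<integral>\<omega>. (X \<omega> - (\<integral>\<omega>'. X \<omega>' \<partial>M)) * (Y \<omega> - (\<integral>\<omega>'. Y \<omega>' \<partial>M)) \<partial>M)"

end

theory Submission
  imports Defs
begin

text \<open>
  All nulls being true, FDR is the probability that anything is rejected. Draw a scenario
  \<open>k \<in> {0..n}\<close> uniformly and then i.i.d. scores. In scenario \<open>k < n\<close> a few scores are positive of size
  about \<open>2 ^ Suc k\<close>, about twice as many are negative of size about \<open>2 ^ k\<close>, and the rest are Gaussian
  with tiny variance. Above \<open>2 ^ Suc k\<close> the positive scores dominate, so for large \<open>m\<close> something is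
  rejected. Masses inversely proportional to size give every scenario mean zero, hence uncorrelated
  scores. The negative mass on each dyadic block is compensated by the positive mass of the preceding
  scenario; scenario \<open>n\<close> (positive of size 1, negative of size \<open>2 ^ n\<close>) closes the cycle, so
  the marginal law is symmetric, and it is the only scenario without guaranteed rejections.
\<close>

section \<open>Thresholds and rejections\<close>

text \<open>Given the scenario the scores are i.i.d., so the covariance of two of them is the
  variance of the scenario mean: zero covariance forces mean zero in every scenario. Symmetry, by
  contrast, must fail inside a scenario, since i.i.d. symmetric continuous scores have independent
  fair signs and knockoff+ then keeps FDR at most q. So symmetry is asked only of the average over
  scenarios. Mean zero still lets the fewer positive scores lie further out than the negative ones;
  beyond \<open>2 ^ Suc k\<close> almost only positive mass is left, and for large m the sample
  follows and also absorbs the 1 in the numerator. The Gaussian fills up the mass and makes the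
  density positive everywhere; being even and centred it disturbs neither symmetry nor means, and
  its variance is chosen so that its tail beyond every cut stays below q times the positive mass
  there. Scenario \<open>n\<close> costs at most 1 / (n + 1) of the probability, which is why the
  bound is 1 - \<eta> and not 1. For the p-values, u = 1 - F t matches the two kinds of threshold,
  and only emptiness of the rejection sets has to be compared.\<close>

lemma finite_score_grid: "finite I \<Longrightarrow> finite (score_grid I w)"
  unfolding score_grid_def by (auto intro: finite_subset[of _ "(\<lambda>i. \<bar>w i\<bar>) ` I"])

lemma finite_mirror_grid: "finite I \<Longrightarrow> finite (mirror_grid I p)"
  unfolding mirror_grid_def by (auto intro: finite_subset[of _ "(\<lambda>i. min (p i) (1 - p i)) ` I"])

lemma ratio_le_iff:
  fixes q :: real and a b :: nat
  assumes "q < 1"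
  shows "(1 + real b) / real (max a 1) \<le> q \<longleftrightarrow> 1 + real b \<le> q * real a"
proof (cases "a = 0")
  case False
  then have "max a 1 = a" by simp
  with False show ?thesis by (simp add: field_simps)
next
  case True
  with assms show ?thesis by simp
qed

lemma knockoff_admissible_iff:
  assumes "q < 1"
  shows "t \<in> knockoff_admissible q I w \<longleftrightarrow>
    t \<in> score_grid I w \<and> 1 + real (N_minus I w t) \<le> q * real (N_plus I w t)"
  unfolding knockoff_admissible_def ratio_le_iff[OF assms] by simp

text \<open>An admissible threshold has \<open>N_plus\<close> nonzero because the numerator is at
  least 1; the default threshold is infinite and no real score reaches it.\<close>

lemma knockoff_rejections_eq_empty_iff:
  assumes "finite I" "q < 1"
  shows "knockoff_rejections q I w = {} \<longleftrightarrow> knockoff_admissible q I w = {}"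
proof (cases "knockoff_admissible q I w = {}")
  case True
  then show ?thesis
    by (simp add: knockoff_rejections_def knockoff_threshold_def)
next
  case False
  define t where "t = Min (knockoff_admissible q I w)"
  have "finite (knockoff_admissible q I w)"
    using finite_score_grid[OF assms(1)] by (auto simp: knockoff_admissible_def)
  then have "t \<in> knockoff_admissible q I w"
    unfolding t_def using False by (rule Min_in)
  then have "1 \<le> q * real (N_plus I w t)"
    unfolding knockoff_admissible_iff[OF assms(2)] by linarith
  then have "N_plus I w t \<noteq> 0" by (intro notI) simp
  then have "{i \<in> I. t \<le> w i} \<noteq> {}"
    unfolding N_plus_def by (metis card.empty)
  then show ?thesis
    using False by (auto simp: knockoff_rejections_def knockoff_threshold_def t_def)
qed

text \<open>The default threshold 0 would reject a p-value equal to 0; positivity of the p-values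
  rules this out.\<close>

lemma mirror_rejections_eq_empty_iff:
  assumes "finite I" "q < 1" "\<And>i. i \<in> I \<Longrightarrow> 0 < p i"
  shows "mirror_rejections q I p = {} \<longleftrightarrow> mirror_admissible q I p = {}"
proof (cases "mirror_admissible q I p = {}")
  case True
  then show ?thesis
    using assms(3) by (force simp: mirror_rejections_def mirror_threshold_def)
next
  case False
  define t where "t = Max (mirror_admissible q I p)"
  have "finite (mirror_admissible q I p)"
    using finite_mirror_grid[OF assms(1)] by (auto simp: mirror_admissible_def)
  then have "t \<in> mirror_admissible q I p"
    unfolding t_def using False by (rule Max_in)
  then have "1 + real (L_count I p t) \<le> q * real (R_count I p t)"
    unfolding mirror_admissible_def ratio_le_iff[OF assms(2)] by simp
  then have "R_count I p t \<noteq> 0" by (intro notI) simp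
  then have "{i \<in> I. p i \<le> t} \<noteq> {}"
    unfolding R_count_def by (metis card.empty)
  then show ?thesis
    using False by (auto simp: mirror_rejections_def mirror_threshold_def t_def)
qed

text \<open>At \<open>s = 0\<close> the zero scores count on both sides; since \<open>q < 1\<close>, removing them keeps the inequality.\<close>

lemma knockoff_admissible_nonempty:
  assumes fin: "finite I" and q: "q < 1" and s: "0 \<le> s"
    and le: "1 + real (N_minus I w s) \<le> q * real (N_plus I w s)"
  shows "knockoff_admissible q I w \<noteq> {}"
proof -
  define Z where "Z = card {i \<in> I. s = 0 \<and> w i = 0}"
  define A where "A = {\<bar>w i\<bar> | i. i \<in> I \<and> s \<le> \<bar>w i\<bar> \<and> 0 < \<bar>w i\<bar>}"
  define t where "t = Min A"
  have finA: "finite A"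
    unfolding A_def using fin by (auto intro: finite_subset[of _ "(\<lambda>i. \<bar>w i\<bar>) ` I"])
  have plus: "N_plus I w s = card {i \<in> I. s \<le> w i \<and> 0 < w i} + Z"
    unfolding N_plus_def Z_def using fin s
    by (subst card_Un_disjoint[symmetric]) (auto intro!: arg_cong[where f = card])
  have minus: "N_minus I w s = card {i \<in> I. w i \<le> - s \<and> w i < 0} + Z"
    unfolding N_minus_def Z_def using fin s
    by (subst card_Un_disjoint[symmetric]) (auto intro!: arg_cong[where f = card])
  have "q * real Z \<le> real Z"
    using q mult_right_mono[of q 1 "real Z"] by simp
  with le have le': "1 + real (card {i \<in> I. w i \<le> - s \<and> w i < 0})
      \<le> q * real (card {i \<in> I. s \<le> w i \<and> 0 < w i})"
    unfolding plus minus by (simp add: algebra_simps)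
  then have "card {i \<in> I. s \<le> w i \<and> 0 < w i} \<noteq> 0" by (intro notI) simp
  then have "{i \<in> I. s \<le> w i \<and> 0 < w i} \<noteq> {}" by (metis card.empty)
  then have "A \<noteq> {}" unfolding A_def by force
  with finA have tA: "t \<in> A" and tle: "\<And>a. a \<in> A \<Longrightarrow> t \<le> a"
    unfolding t_def by auto
  from tA have t: "s \<le> t" "0 < t" "t \<in> score_grid I w"
    unfolding A_def score_grid_def by auto
  \<comment> \<open>No nonzero score has magnitude at least \<open>s\<close> but below
    \<open>t\<close>, so moving from the arbitrary cut \<open>s\<close> to the grid point
    \<open>t\<close> changes neither count.\<close>
  have "{i \<in> I. s \<le> w i \<and> 0 < w i} = {i \<in> I. t \<le> w i}"
  proof (intro Collect_cong conj_cong refl iffI)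
    fix i assume "i \<in> I" "s \<le> w i \<and> 0 < w i"
    then have "\<bar>w i\<bar> \<in> A" unfolding A_def using abs_of_pos by fastforce
    from tle[OF this] show "t \<le> w i" using \<open>s \<le> w i \<and> 0 < w i\<close> by simp
  qed (use t in auto)
  moreover have "{i \<in> I. w i \<le> - s \<and> w i < 0} = {i \<in> I. w i \<le> - t}"
  proof (intro Collect_cong conj_cong refl iffI)
    fix i assume "i \<in> I" "w i \<le> - s \<and> w i < 0"
    then have "\<bar>w i\<bar> \<in> A" unfolding A_def by fastforce
    from tle[OF this] show "w i \<le> - t" using \<open>w i \<le> - s \<and> w i < 0\<close> by simp
  qed (use t in auto)
  ultimately have "t \<in> knockoff_admissible q I w"
    using le' t(3) by (simp add: knockoff_admissible_iff[OF q] N_plus_def N_minus_def)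
  then show ?thesis by blast
qed

text \<open>Indices with \<open>w i = 0\<close> are tried here too, although the score grid omits
  magnitude 0. This form is needed because the mirror grid does contain the corresponding point u =
  1/2.\<close>

lemma knockoff_admissible_nonempty_iff:
  assumes "finite I" "q < 1"
  shows "knockoff_admissible q I w \<noteq> {} \<longleftrightarrow>
    (\<exists>i\<in>I. 1 + real (N_minus I w \<bar>w i\<bar>) \<le> q * real (N_plus I w \<bar>w i\<bar>))"
  using knockoff_admissible_nonempty[OF assms, of "\<bar>w _\<bar>" w]
  by (auto simp: knockoff_admissible_iff[OF assms(2)] score_grid_def)

text \<open>Under u = 1 - F t the condition p <= u becomes w >= t by monotonicity, and p >= 1 - u
  becomes w <= - t by symmetry. So both counts agree, and the mirror grid is the image of all score
  magnitudes.\<close>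

lemma mirror_admissible_empty_iff:
  fixes F :: "real \<Rightarrow> real"
  assumes fin: "finite I" and q: "q < 1" and F: "strict_mono F"
    and sym: "\<And>x. F (- x) = 1 - F x" and less1: "\<And>x. F x < 1"
    and p: "\<And>i. i \<in> I \<Longrightarrow> p i = 1 - F (w i)"
  shows "mirror_admissible q I p = {} \<longleftrightarrow> knockoff_admissible q I w = {}"
proof -
  have F0: "F 0 = 1/2" using sym[of 0] by simp
  have R: "R_count I p (1 - F t) = N_plus I w t" for t
    unfolding R_count_def N_plus_def
    by (rule arg_cong[where f = card]) (auto simp: p strict_mono_less_eq[OF F])
  have L: "L_count I p (1 - F t) = N_minus I w t" for t
    unfolding L_count_def N_minus_def
    by (rule arg_cong[where f = card]) (auto simp: p strict_mono_less_eq[OF F] simp flip: sym)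
  have min_eq: "min (1 - F x) (F x) = 1 - F \<bar>x\<bar>" for x
    using strict_mono_less_eq[OF F, of x "- x"] F0
    by (cases "x = 0"; cases "0 \<le> x") (auto simp: sym min_def)
  have grid: "mirror_grid I p = {1 - F \<bar>w i\<bar> | i. i \<in> I}"
  proof -
    have "1 - F \<bar>x\<bar> \<in> {0<..1/2}" for x
      using less1[of "\<bar>x\<bar>"] strict_mono_less_eq[OF F, of 0 "\<bar>x\<bar>"] F0 by auto
    moreover have "min (p i) (1 - p i) = 1 - F \<bar>w i\<bar>" if "i \<in> I" for i
      using min_eq[of "w i"] that by (simp add: p)
    ultimately show ?thesis
      unfolding mirror_grid_def Setcompr_eq_image by auto
  qed
  have "mirror_admissible q I p \<noteq> {} \<longleftrightarrow>
      (\<exists>i\<in>I. 1 + real (N_minus I w \<bar>w i\<bar>) \<le> q * real (N_plus I w \<bar>w i\<bar>))"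
    unfolding mirror_admissible_def grid ratio_le_iff[OF q] by (auto simp: R L)
  also have "\<dots> \<longleftrightarrow> knockoff_admissible q I w \<noteq> {}"
    by (rule knockoff_admissible_nonempty_iff[OF fin q, symmetric])
  finally show ?thesis by blast
qed

section \<open>Conditionally i.i.d. scores\<close>

text \<open>A product measure is determined by its values on boxes; the indicator of a box factors
  over the coordinates, and the integral of the product splits.\<close>

lemma (in product_sigma_finite) PiM_density:
  assumes fin: "finite I" and f[measurable]: "\<And>i. f i \<in> borel_measurable (M i)"
    and sf: "product_sigma_finite (\<lambda>i. density (M i) (f i))"
  shows "PiM I (\<lambda>i. density (M i) (f i)) = density (PiM I M) (\<lambda>x. \<Prod>i\<in>I. f i (x i))"
proof (rule product_sigma_finite.PiM_eqI[OF sf fin, symmetric])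
  show "sets (density (PiM I M) (\<lambda>x. \<Prod>i\<in>I. f i (x i))) = sets (PiM I (\<lambda>i. density (M i) (f i)))"
    unfolding sets_density by (rule sets_PiM_cong) auto
next
  fix A assume "\<And>i. i \<in> I \<Longrightarrow> A i \<in> sets (density (M i) (f i))"
  then have A[measurable]: "\<And>i. i \<in> I \<Longrightarrow> A i \<in> sets (M i)" by simp
  have box: "Pi\<^sub>E I A \<in> sets (PiM I M)"
    using fin A by (rule sets_PiM_I_finite)
  have [measurable]: "(\<lambda>x. \<Prod>i\<in>I. f i (x i)) \<in> borel_measurable (PiM I M)"
    by measurable
  have "emeasure (density (PiM I M) (\<lambda>x. \<Prod>i\<in>I. f i (x i))) (Pi\<^sub>E I A) =
      (\<integral>\<^sup>+x. (\<Prod>i\<in>I. f i (x i)) * indicator (Pi\<^sub>E I A) x \<partial>PiM I M)"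
    using box by (intro emeasure_density) auto
  also have "\<dots> = (\<integral>\<^sup>+x. (\<Prod>i\<in>I. f i (x i) * indicator (A i) (x i)) \<partial>PiM I M)"
  proof (rule nn_integral_cong)
    fix x assume x: "x \<in> space (PiM I M)"
    have "indicator (Pi\<^sub>E I A) x = (\<Prod>i\<in>I. indicator (A i) (x i) :: ennreal)"
    proof (cases "x \<in> Pi\<^sub>E I A")
      case True
      then have "(\<Prod>i\<in>I. indicator (A i) (x i) :: ennreal) = 1"
        by (intro prod.neutral) (auto simp: PiE_iff)
      with True show ?thesis by simp
    next
      case False
      with x obtain i where "i \<in> I" "x i \<notin> A i"
        by (auto simp: space_PiM PiE_iff)
      then have "(\<Prod>i\<in>I. indicator (A i) (x i) :: ennreal) = 0"
        using fin by (intro prod_zero) (auto intro!: bexI[of _ i])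
      with False show ?thesis by simp
    qed
    then show "(\<Prod>i\<in>I. f i (x i)) * indicator (Pi\<^sub>E I A) x =
        (\<Prod>i\<in>I. f i (x i) * indicator (A i) (x i))"
      by (simp add: prod.distrib)
  qed
  also have "\<dots> = (\<Prod>i\<in>I. \<integral>\<^sup>+x. f i x * indicator (A i) x \<partial>M i)"
    using fin by (intro product_nn_integral_prod) auto
  also have "\<dots> = (\<Prod>i\<in>I. emeasure (density (M i) (f i)) (A i))"
    by (intro prod.cong) (auto simp: emeasure_density)
  finally show "emeasure (density (PiM I M) (\<lambda>x. \<Prod>i\<in>I. f i (x i))) (Pi\<^sub>E I A) =
      (\<Prod>i\<in>I. emeasure (density (M i) (f i)) (A i))" .
qed

lemma PiM_density_lborel:
  fixes g :: "real \<Rightarrow> real"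
  assumes "finite I" "g \<in> borel_measurable borel" "\<And>x. 0 \<le> g x"
    and "prob_space (density lborel (\<lambda>x. ennreal (g x)))"
  shows "(\<Pi>\<^sub>M i\<in>I. density lborel (\<lambda>x. ennreal (g x))) =
    density (\<Pi>\<^sub>M i\<in>I. lborel) (\<lambda>x. ennreal (\<Prod>i\<in>I. g (x i)))"
proof -
  interpret product_sigma_finite "\<lambda>_. lborel :: real measure"
    by (simp add: product_sigma_finite_def lborel.sigma_finite_measure_axioms)
  have "product_sigma_finite (\<lambda>_. density lborel (\<lambda>x. ennreal (g x)))"
    using assms(4) by (simp add: product_sigma_finite_def prob_space_imp_sigma_finite)
  from PiM_density[OF assms(1) _ this, simplified] assms(2,3) show ?thesis
    by (simp add: prod_ennreal)
qed

text \<open>Applying \<open>T\<close> in every coordinate commutes with permuting coordinates, so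
  both laws of \<open>Y\<close> are images of equal laws of \<open>X\<close> under one map.\<close>

lemma exchangeable_compose:
  assumes X: "\<And>i. i \<in> I \<Longrightarrow> X i \<in> borel_measurable M" and T[measurable]: "T \<in> borel_measurable borel"
    and "exchangeable M I X" and Y: "\<And>i \<omega>. i \<in> I \<Longrightarrow> Y i \<omega> = T (X i \<omega>)"
  shows "exchangeable M I Y"
  unfolding exchangeable_def
proof (intro allI impI)
  fix \<pi> assume \<pi>: "\<pi> permutes I"
  have *: "distr M (\<Pi>\<^sub>M i\<in>I. borel) (\<lambda>\<omega>. \<lambda>i\<in>I. Y (\<sigma> i) \<omega>) =
      distr (distr M (\<Pi>\<^sub>M i\<in>I. borel) (\<lambda>\<omega>. \<lambda>i\<in>I. X (\<sigma> i) \<omega>)) (\<Pi>\<^sub>M i\<in>I. borel) (\<lambda>x. \<lambda>i\<in>I. T (x i))"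
    if \<sigma>: "\<sigma> permutes I" for \<sigma>
  proof -
    have in_I: "\<sigma> i \<in> I" if "i \<in> I" for i using \<sigma> that by (simp add: permutes_in_image)
    have m: "(\<lambda>\<omega>. \<lambda>i\<in>I. X (\<sigma> i) \<omega>) \<in> measurable M (\<Pi>\<^sub>M i\<in>I. borel)"
      using X in_I by (intro measurable_restrict) auto
    show ?thesis
      by (subst distr_distr[OF _ m])
        (auto intro!: distr_cong simp: Y in_I fun_eq_iff)
  qed
  from *[OF \<pi>] *[OF permutes_id] assms(3) \<pi>
  show "distr M (\<Pi>\<^sub>M i\<in>I. borel) (\<lambda>\<omega>. \<lambda>i\<in>I. Y (\<pi> i) \<omega>) = distr M (\<Pi>\<^sub>M i\<in>I. borel) (\<lambda>\<omega>. \<lambda>i\<in>I. Y i \<omega>)"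
    unfolding exchangeable_def by simp
qed

text \<open>Every rejection is false, so the false discovery proportion takes only the values 0 and
  1.\<close>

lemma FDR_all_null:
  assumes "finite I" and "\<And>\<omega>. Rej \<omega> \<subseteq> I"
  shows "FDR M I Rej = (\<integral>\<omega>. (if Rej \<omega> = {} then 0 else 1) \<partial>M)"
  unfolding FDR_def
proof (rule Bochner_Integration.integral_cong[OF refl])
  fix \<omega>
  have "Rej \<omega> \<inter> I = Rej \<omega>" "finite (Rej \<omega>)"
    using assms finite_subset by blast+
  then show "real (card (Rej \<omega> \<inter> I)) / real (max (card (Rej \<omega>)) 1) = (if Rej \<omega> = {} then 0 else 1)"
    by (cases "Rej \<omega> = {}") (auto simp: max_def card_eq_0_iff le_Suc_eq)
qed

text \<open>Centring is required of each scenario, evenness only of the sum, that is of the marginal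
  density. \<open>f_second_moment\<close> provides the integrability without which a zero covariance
  could be a mere default value of the integral.\<close>

locale score_mixture =
  fixes n :: nat and f :: "nat \<Rightarrow> real \<Rightarrow> real"
  assumes f_measurable [measurable]: "\<And>k. f k \<in> borel_measurable borel"
    and f_pos: "\<And>k x. 0 < f k x"
    and f_total: "\<And>k. (\<integral>\<^sup>+x. ennreal (f k x) \<partial>lborel) = 1"
    and f_second_moment: "\<And>k. integrable lborel (\<lambda>x. f k x * x\<^sup>2)"
    and f_mean: "\<And>k. (\<integral>x. f k x * x \<partial>lborel) = 0"
    and f_even: "\<And>x. (\<Sum>k\<le>n. f k (- x)) = (\<Sum>k\<le>n. f k x)"
begin

definition marg :: "nat \<Rightarrow> real measure" where
  "marg k = density lborel (\<lambda>x. ennreal (f k x))"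

definition fbar :: "real \<Rightarrow> real" where
  "fbar x = (\<Sum>k\<le>n. f k x) / real (Suc n)"

definition \<mu> :: "real measure" where
  "\<mu> = density lborel (\<lambda>x. ennreal (fbar x))"

definition joint :: "'i set \<Rightarrow> ('i \<Rightarrow> real) \<Rightarrow> real" where
  "joint I x = (\<Sum>k\<le>n. \<Prod>i\<in>I. f k (x i)) / real (Suc n)"

text \<open>Given by its density rather than as a mixture of measures, so that positivity of the
  joint density is immediate. The scores are the coordinate projections.\<close>

definition law :: "'i set \<Rightarrow> ('i \<Rightarrow> real) measure" where
  "law I = density (\<Pi>\<^sub>M i\<in>I. lborel) (\<lambda>x. ennreal (joint I x))"

lemma sets_marg [simp, measurable_cong]: "sets (marg k) = sets borel"
  and space_marg [simp]: "space (marg k) = UNIV"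
  by (simp_all add: marg_def)

lemma prob_space_marg: "prob_space (marg k)"
  by (rule prob_spaceI) (simp add: marg_def emeasure_density f_total)

lemma fbar_pos: "0 < fbar x"
  unfolding fbar_def using f_pos by (auto intro!: divide_pos_pos sum_pos)

lemma fbar_measurable [measurable]: "fbar \<in> borel_measurable borel"
  unfolding fbar_def[abs_def] by measurable

lemma fbar_even: "fbar (- x) = fbar x"
  unfolding fbar_def f_even ..

lemma joint_pos: "0 < joint I x"
  unfolding joint_def using f_pos by (auto intro!: divide_pos_pos sum_pos prod_pos)

lemma joint_measurable [measurable]: "joint I \<in> borel_measurable (\<Pi>\<^sub>M i\<in>I. lborel)"
  unfolding joint_def[abs_def] by measurable

lemma sets_law [simp, measurable_cong]: "sets (law I) = sets (\<Pi>\<^sub>M i\<in>I. borel)"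
  unfolding law_def sets_density by (rule sets_PiM_cong) auto

lemma space_law [simp]: "space (law I) = (\<Pi>\<^sub>E i\<in>I. UNIV)"
  by (simp add: law_def space_PiM)

lemma sets_PiM_marg [simp, measurable_cong]: "sets (\<Pi>\<^sub>M i\<in>I. marg k) = sets (\<Pi>\<^sub>M i\<in>I. borel)"
  by (rule sets_PiM_cong) auto

lemma PiM_marg:
  assumes "finite I"
  shows "(\<Pi>\<^sub>M i\<in>I. marg k) = density (\<Pi>\<^sub>M i\<in>I. lborel) (\<lambda>x. ennreal (\<Prod>i\<in>I. f k (x i)))"
  using PiM_density_lborel[OF assms, of "f k"] prob_space_marg[of k]
  by (simp add: marg_def less_imp_le[OF f_pos])

text \<open>Recovers the two-stage description, a uniform scenario followed by i.i.d. draws.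
  Exchangeability and the one-coordinate marginals then reduce to facts about product
  measures.\<close>

lemma emeasure_law:
  assumes "finite I" and A[measurable]: "A \<in> sets (\<Pi>\<^sub>M i\<in>I. borel)"
  shows "emeasure (law I) A = (\<Sum>k\<le>n. emeasure (\<Pi>\<^sub>M i\<in>I. marg k) A) / ennreal (real (Suc n))"
proof -
  have [measurable_cong]: "sets (\<Pi>\<^sub>M i\<in>I. lborel :: real measure) = sets (\<Pi>\<^sub>M i\<in>I. borel)"
    by (rule sets_PiM_cong) auto
  have A': "A \<in> sets (\<Pi>\<^sub>M i\<in>I. lborel)" by measurable
  have "emeasure (law I) A = (\<integral>\<^sup>+x. ennreal (joint I x) * indicator A x \<partial>(\<Pi>\<^sub>M i\<in>I. lborel))"
    unfolding law_def using A' by (intro emeasure_density) auto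
  also have "\<dots> = (\<integral>\<^sup>+x. (\<Sum>k\<le>n. ennreal (\<Prod>i\<in>I. f k (x i)) * indicator A x) / ennreal (real (Suc n))
      \<partial>(\<Pi>\<^sub>M i\<in>I. lborel))"
  proof (intro nn_integral_cong)
    fix x
    show "ennreal (joint I x) * indicator A x =
        (\<Sum>k\<le>n. ennreal (\<Prod>i\<in>I. f k (x i)) * indicator A x) / ennreal (real (Suc n))"
      by (cases "x \<in> A") (simp_all add: joint_def divide_ennreal[symmetric] sum_ennreal sum_nonneg prod_nonneg
        less_imp_le[OF f_pos] del: of_nat_Suc)
  qed
  also have "\<dots> = (\<Sum>k\<le>n. \<integral>\<^sup>+x. ennreal (\<Prod>i\<in>I. f k (x i)) * indicator A x \<partial>(\<Pi>\<^sub>M i\<in>I. lborel))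
      / ennreal (real (Suc n))"
    by (subst nn_integral_divide, measurable) (subst nn_integral_sum, auto)
  also have "\<dots> = (\<Sum>k\<le>n. emeasure (\<Pi>\<^sub>M i\<in>I. marg k) A) / ennreal (real (Suc n))"
    using A' by (simp add: PiM_marg[OF assms(1)] emeasure_density)
  finally show ?thesis .
qed

lemma emeasure_\<mu>:
  assumes [measurable]: "A \<in> sets borel"
  shows "emeasure \<mu> A = (\<Sum>k\<le>n. emeasure (marg k) A) / ennreal (real (Suc n))"
proof -
  have "emeasure \<mu> A = (\<integral>\<^sup>+x. ennreal (fbar x) * indicator A x \<partial>lborel)"
    unfolding \<mu>_def by (intro emeasure_density) auto
  also have "\<dots> = (\<integral>\<^sup>+x. (\<Sum>k\<le>n. ennreal (f k x) * indicator A x) / ennreal (real (Suc n)) \<partial>lborel)"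
  proof (intro nn_integral_cong)
    fix x
    show "ennreal (fbar x) * indicator A x =
        (\<Sum>k\<le>n. ennreal (f k x) * indicator A x) / ennreal (real (Suc n))"
      by (cases "x \<in> A") (simp_all add: fbar_def divide_ennreal[symmetric] sum_ennreal sum_nonneg
        less_imp_le[OF f_pos] del: of_nat_Suc)
  qed
  also have "\<dots> = (\<Sum>k\<le>n. \<integral>\<^sup>+x. ennreal (f k x) * indicator A x \<partial>lborel) / ennreal (real (Suc n))"
    by (subst nn_integral_divide, measurable) (subst nn_integral_sum, auto)
  also have "\<dots> = (\<Sum>k\<le>n. emeasure (marg k) A) / ennreal (real (Suc n))"
    by (simp add: marg_def emeasure_density)
  finally show ?thesis .
qed

lemma sets_\<mu> [simp, measurable_cong]: "sets \<mu> = sets borel"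
  and space_\<mu> [simp]: "space \<mu> = UNIV"
  by (simp_all add: \<mu>_def)

lemma prob_space_PiM_marg: "prob_space (\<Pi>\<^sub>M i\<in>I. marg k)"
  by (intro prob_space_PiM prob_space_marg)

lemma Suc_n_divide_self: "(\<Sum>k\<le>n. (1::ennreal)) / ennreal (real (Suc n)) = 1"
proof -
  have "(\<Sum>k\<le>n. (1::ennreal)) = ennreal (real (Suc n))"
    by (simp only: sum_constant card_atMost mult_1_right ennreal_of_nat_eq_real_of_nat)
  then show ?thesis by (simp add: divide_ennreal del: of_nat_Suc)
qed

lemma prob_space_law:
  assumes "finite I" shows "prob_space (law I)"
proof (rule prob_spaceI)
  have "emeasure (\<Pi>\<^sub>M i\<in>I. marg k) (\<Pi>\<^sub>E i\<in>I. UNIV) = 1" for k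
    using prob_space.emeasure_space_1[OF prob_space_PiM_marg] by (simp add: space_PiM)
  moreover have "(\<Pi>\<^sub>E i\<in>I. UNIV) \<in> sets (\<Pi>\<^sub>M i\<in>I. borel :: real measure)"
    using sets.top[of "\<Pi>\<^sub>M i\<in>I. borel :: real measure"] by (simp add: space_PiM)
  ultimately show "emeasure (law I) (space (law I)) = 1"
    using Suc_n_divide_self by (simp add: emeasure_law[OF assms] del: of_nat_Suc)
qed

lemma prob_space_\<mu>: "prob_space \<mu>"
proof (rule prob_spaceI)
  have "emeasure (marg k) UNIV = 1" for k
    using prob_space.emeasure_space_1[OF prob_space_marg] by simp
  then show "emeasure \<mu> (space \<mu>) = 1"
    using Suc_n_divide_self by (simp add: emeasure_\<mu> del: of_nat_Suc)
qed

lemma distr_law_component: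
  assumes "finite I" "i \<in> I"
  shows "distr (law I) borel (\<lambda>\<omega>. \<omega> i) = \<mu>"
proof (rule measure_eqI)
  fix A :: "real set" assume "A \<in> sets (distr (law I) borel (\<lambda>\<omega>. \<omega> i))"
  then have A[measurable]: "A \<in> sets borel" by simp
  have m[measurable]: "(\<lambda>\<omega>. \<omega> i) \<in> borel_measurable (\<Pi>\<^sub>M i\<in>I. borel)"
    using assms(2) by measurable
  have *: "emeasure (marg k) A = emeasure (\<Pi>\<^sub>M i\<in>I. marg k) ((\<lambda>\<omega>. \<omega> i) -` A \<inter> space (\<Pi>\<^sub>M i\<in>I. borel))" for k
  proof -
    have "distr (\<Pi>\<^sub>M i\<in>I. marg k) (marg k) (\<lambda>\<omega>. \<omega> i) = marg k"
      using assms(2) prob_space_marg by (intro distr_PiM_component) auto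
    then have "emeasure (marg k) A = emeasure (distr (\<Pi>\<^sub>M i\<in>I. marg k) (marg k) (\<lambda>\<omega>. \<omega> i)) A" by simp
    also have "\<dots> = emeasure (\<Pi>\<^sub>M i\<in>I. marg k) ((\<lambda>\<omega>. \<omega> i) -` A \<inter> space (\<Pi>\<^sub>M i\<in>I. marg k))"
      by (rule emeasure_distr) (use assms(2) A in auto)
    finally show ?thesis by (simp add: space_PiM)
  qed
  have "emeasure (distr (law I) borel (\<lambda>\<omega>. \<omega> i)) A = emeasure (law I) ((\<lambda>\<omega>. \<omega> i) -` A \<inter> space (\<Pi>\<^sub>M i\<in>I. borel))"
    by (subst emeasure_distr) (auto simp: space_PiM)
  also have "\<dots> = emeasure \<mu> A"
    unfolding emeasure_\<mu>[OF A] * by (intro emeasure_law assms(1) measurable_sets[OF m A])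
  finally show "emeasure (distr (law I) borel (\<lambda>\<omega>. \<omega> i)) A = emeasure \<mu> A" .
qed simp

text \<open>Each scenario is a product of identical factors and hence invariant under reindexing; an
  average of invariant measures is invariant.\<close>

lemma exchangeable_law:
  assumes "finite I"
  shows "exchangeable (law I) I (\<lambda>i \<omega>. \<omega> i)"
  unfolding exchangeable_def
proof (intro allI impI)
  fix \<pi> assume \<pi>: "\<pi> permutes I"
  let ?B = "\<Pi>\<^sub>M i\<in>I. borel :: real measure"
  have in_I: "\<pi> i \<in> I" if "i \<in> I" for i using \<pi> that by (simp add: permutes_in_image)
  have m: "(\<lambda>\<omega>. \<lambda>i\<in>I. \<omega> (\<pi> i)) \<in> measurable ?B ?B"
    using in_I by (intro measurable_restrict measurable_component_singleton) auto
  have "distr (law I) ?B (\<lambda>\<omega>. \<lambda>i\<in>I. \<omega> (\<pi> i)) = law I"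
  proof (rule measure_eqI)
    fix A assume "A \<in> sets (distr (law I) ?B (\<lambda>\<omega>. \<lambda>i\<in>I. \<omega> (\<pi> i)))"
    then have A: "A \<in> sets ?B" by simp
    have *: "emeasure (\<Pi>\<^sub>M i\<in>I. marg k) ((\<lambda>\<omega>. \<lambda>i\<in>I. \<omega> (\<pi> i)) -` A \<inter> space ?B) =
        emeasure (\<Pi>\<^sub>M i\<in>I. marg k) A" for k
    proof -
      have "distr (\<Pi>\<^sub>M i\<in>I. marg k) (\<Pi>\<^sub>M i\<in>I. marg k) (\<lambda>\<omega>. \<lambda>i\<in>I. \<omega> (\<pi> i)) = (\<Pi>\<^sub>M i\<in>I. marg k)"
        using prob_space_marg in_I permutes_inj_on[OF \<pi>]
        by (intro distr_PiM_reindex[where M = "\<lambda>_. marg k"]) auto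
      then have "emeasure (\<Pi>\<^sub>M i\<in>I. marg k) A =
          emeasure (distr (\<Pi>\<^sub>M i\<in>I. marg k) (\<Pi>\<^sub>M i\<in>I. marg k) (\<lambda>\<omega>. \<lambda>i\<in>I. \<omega> (\<pi> i))) A" by simp
      also have "\<dots> = emeasure (\<Pi>\<^sub>M i\<in>I. marg k) ((\<lambda>\<omega>. \<lambda>i\<in>I. \<omega> (\<pi> i)) -` A \<inter> space (\<Pi>\<^sub>M i\<in>I. marg k))"
        by (rule emeasure_distr) (use m A in \<open>auto cong: measurable_cong_sets\<close>)
      finally show ?thesis by (simp add: space_PiM)
    qed
    have "emeasure (distr (law I) ?B (\<lambda>\<omega>. \<lambda>i\<in>I. \<omega> (\<pi> i))) A =
        emeasure (law I) ((\<lambda>\<omega>. \<lambda>i\<in>I. \<omega> (\<pi> i)) -` A \<inter> space ?B)"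
      using m A by (subst emeasure_distr) (auto simp: space_PiM cong: measurable_cong_sets)
    also have "\<dots> = emeasure (law I) A"
      unfolding emeasure_law[OF assms A] emeasure_law[OF assms measurable_sets[OF m A]] * ..
    finally show "emeasure (distr (law I) ?B (\<lambda>\<omega>. \<lambda>i\<in>I. \<omega> (\<pi> i))) A = emeasure (law I) A" .
  qed simp
  moreover have "distr (law I) ?B (\<lambda>\<omega>. \<lambda>i\<in>I. \<omega> i) = law I"
  proof -
    have "distr (law I) ?B (\<lambda>\<omega>. \<lambda>i\<in>I. \<omega> i) = distr (law I) (law I) (\<lambda>\<omega>. \<omega>)"
      by (intro distr_cong) (auto simp: PiE_iff restrict_def extensional_def fun_eq_iff)
    then show ?thesis by simp
  qed
  ultimately show "distr (law I) ?B (\<lambda>\<omega>. \<lambda>i\<in>I. \<omega> (\<pi> i)) = distr (law I) ?B (\<lambda>\<omega>. \<lambda>i\<in>I. \<omega> i)"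
    by simp
qed

lemma joint_density_law:
  assumes "finite I"
  shows "has_joint_density_pos_on (law I) I (\<lambda>i \<omega>. \<omega> i) A"
proof -
  have "distr (law I) (\<Pi>\<^sub>M i\<in>I. lborel) (\<lambda>\<omega>. \<lambda>i\<in>I. \<omega> i) = distr (law I) (law I) (\<lambda>\<omega>. \<omega>)"
    by (intro distr_cong) (auto simp: law_def PiE_iff space_PiM restrict_def extensional_def fun_eq_iff)
  moreover have "(\<lambda>\<omega>. \<lambda>i\<in>I. \<omega> i) \<in> measurable (law I) (\<Pi>\<^sub>M i\<in>I. lborel)"
    unfolding law_def by measurable
  ultimately have "distributed (law I) (\<Pi>\<^sub>M i\<in>I. lborel) (\<lambda>\<omega>. \<lambda>i\<in>I. \<omega> i) (\<lambda>x. ennreal (joint I x))"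
    unfolding distributed_def by (simp add: law_def)
  then show ?thesis
    unfolding has_joint_density_pos_on_def using joint_pos less_imp_le[OF joint_pos] by blast
qed

text \<open>Reflection preserves Lebesgue measure, and the averaged density \<open>fbar\<close> is
  even.\<close>

lemma distr_uminus_\<mu>: "distr \<mu> borel uminus = \<mu>"
proof -
  have "\<mu> = density (distr lborel borel uminus) (\<lambda>x. ennreal (fbar x))"
    by (simp add: \<mu>_def lborel_distr_uminus)
  also have "\<dots> = distr (density lborel (\<lambda>x. ennreal (fbar (- x)))) borel uminus"
    by (rule density_distr) auto
  also have "\<dots> = distr \<mu> borel uminus"
    by (simp add: fbar_even \<mu>_def)
  finally show ?thesis ..
qed

section \<open>Moments of the mixture and zero covariance\<close>

lemma expectation_PiM_marg_prod:
  fixes g :: "'i \<Rightarrow> real \<Rightarrow> real"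
  assumes "finite I" "\<And>i. i \<in> I \<Longrightarrow> integrable (marg k) (g i)"
  shows "integrable (\<Pi>\<^sub>M i\<in>I. marg k) (\<lambda>x. \<Prod>i\<in>I. g i (x i))"
    and "(\<integral>x. (\<Prod>i\<in>I. g i (x i)) \<partial>(\<Pi>\<^sub>M i\<in>I. marg k)) = (\<Prod>i\<in>I. \<integral>x. g i x \<partial>marg k)"
proof -
  interpret product_sigma_finite "\<lambda>_. marg k"
    by (simp add: product_sigma_finite_def prob_space_imp_sigma_finite prob_space_marg)
  show "integrable (\<Pi>\<^sub>M i\<in>I. marg k) (\<lambda>x. \<Prod>i\<in>I. g i (x i))"
    using assms by (rule product_integrable_prod)
  show "(\<integral>x. (\<Prod>i\<in>I. g i (x i)) \<partial>(\<Pi>\<^sub>M i\<in>I. marg k)) = (\<Prod>i\<in>I. \<integral>x. g i x \<partial>marg k)"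
    using assms by (rule product_integral_prod)
qed

lemma law_integral:
  fixes g :: "('i \<Rightarrow> real) \<Rightarrow> real"
  assumes "finite I" and int: "\<And>k. integrable (\<Pi>\<^sub>M i\<in>I. marg k) g"
  shows "integrable (law I) g"
    and "(\<integral>x. g x \<partial>law I) = (\<Sum>k\<le>n. \<integral>x. g x \<partial>(\<Pi>\<^sub>M i\<in>I. marg k)) / real (Suc n)"
proof -
  let ?L = "\<Pi>\<^sub>M i\<in>I. lborel :: real measure"
  have [measurable]: "g \<in> borel_measurable ?L"
    using borel_measurable_integrable[OF int[of 0]] by (simp add: PiM_marg[OF assms(1)])
  have nonneg: "0 \<le> (\<Prod>i\<in>I. f k (x i))" for k x
    by (intro prod_nonneg) (simp add: less_imp_le[OF f_pos])
  have int': "integrable ?L (\<lambda>x. (\<Prod>i\<in>I. f k (x i)) * g x)" for k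
    using int[of k] unfolding PiM_marg[OF assms(1)]
    by (subst (asm) integrable_density) (auto simp: nonneg)
  have eq': "(\<integral>x. g x \<partial>(\<Pi>\<^sub>M i\<in>I. marg k)) = (\<integral>x. (\<Prod>i\<in>I. f k (x i)) * g x \<partial>?L)" for k
    unfolding PiM_marg[OF assms(1)] by (subst integral_density) (auto simp: nonneg)
  have expand: "joint I x *\<^sub>R g x = (\<Sum>k\<le>n. (\<Prod>i\<in>I. f k (x i)) * g x) / real (Suc n)" for x
    by (simp add: joint_def sum_distrib_right)
  show "integrable (law I) g"
  proof -
    have "integrable ?L (\<lambda>x. joint I x *\<^sub>R g x)"
      unfolding expand using int' by (intro integrable_divide Bochner_Integration.integrable_sum)
    then show ?thesis
      unfolding law_def by (subst integrable_density) (auto simp: less_imp_le[OF joint_pos])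
  qed
  have "(\<integral>x. g x \<partial>law I) = (\<integral>x. joint I x *\<^sub>R g x \<partial>?L)"
    unfolding law_def by (rule integral_density) (auto simp: less_imp_le[OF joint_pos])
  also have "\<dots> = (\<Sum>k\<le>n. \<integral>x. g x \<partial>(\<Pi>\<^sub>M i\<in>I. marg k)) / real (Suc n)"
    unfolding expand eq' using int' by (simp del: of_nat_Suc)
  finally show "(\<integral>x. g x \<partial>law I) = (\<Sum>k\<le>n. \<integral>x. g x \<partial>(\<Pi>\<^sub>M i\<in>I. marg k)) / real (Suc n)" .
qed

lemma marg_moments:
  shows "integrable (marg k) (\<lambda>x. x\<^sup>2)" and "integrable (marg k) (\<lambda>x. x)"
    and "(\<integral>x. x \<partial>marg k) = 0"
proof -
  interpret prob_space "marg k" by (rule prob_space_marg)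
  show 2: "integrable (marg k) (\<lambda>x. x\<^sup>2)"
    unfolding marg_def using f_second_moment[of k]
    by (subst integrable_density) (auto simp: less_imp_le[OF f_pos])
  show "integrable (marg k) (\<lambda>x. x)"
    by (rule square_integrable_imp_integrable[OF _ 2]) simp
  show "(\<integral>x. x \<partial>marg k) = 0"
    unfolding marg_def using f_mean[of k]
    by (subst integral_density) (auto simp: less_imp_le[OF f_pos])
qed

text \<open>A monomial in the coordinates is written as a product over all of \<open>I\<close> with
  factor 1 elsewhere; within each scenario the integral factors, and one centred factor makes it
  vanish.\<close>

lemma law_moments:
  assumes "finite I" "i \<in> I"
  shows "integrable (law I) (\<lambda>\<omega>. (\<omega> i)\<^sup>2)" and "(\<integral>\<omega>. \<omega> i \<partial>law I) = 0"
    and "j \<in> I \<Longrightarrow> i \<noteq> j \<Longrightarrow> (\<integral>\<omega>. \<omega> i * \<omega> j \<partial>law I) = 0"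
proof -
  have one: "integrable (marg k) (\<lambda>x. 1 :: real)" for k
    using prob_space_marg[of k] by (simp add: prob_space.finite_measure finite_measure.integrable_const)
  have single: "(\<Prod>l\<in>I. (if l = i then g else (\<lambda>_. 1)) (x l)) = g (x i)" for g :: "real \<Rightarrow> real" and x
    using assms by (subst prod.mono_neutral_right[of I "{i}"]) auto
  have "integrable (\<Pi>\<^sub>M l\<in>I. marg k) (\<lambda>\<omega>. (\<omega> i)\<^sup>2)" for k
    using expectation_PiM_marg_prod(1)[OF assms(1), of k "\<lambda>l. if l = i then (\<lambda>x. x\<^sup>2) else (\<lambda>_. 1)"]
      one marg_moments(1) by (simp add: single)
  then show "integrable (law I) (\<lambda>\<omega>. (\<omega> i)\<^sup>2)"
    by (rule law_integral(1)[OF assms(1)])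
  have prod_if: "(\<Prod>l\<in>I. \<integral>x. (if l \<in> J then (\<lambda>x. x) else (\<lambda>_. 1)) x \<partial>marg k) = 0" if "i \<in> J" for J and k
    using assms that by (intro prod_zero) (auto intro!: bexI[of _ i] simp: marg_moments)
  have i1: "integrable (\<Pi>\<^sub>M l\<in>I. marg k) (\<lambda>\<omega>. \<omega> i)" "(\<integral>\<omega>. \<omega> i \<partial>(\<Pi>\<^sub>M l\<in>I. marg k)) = 0" for k
    using expectation_PiM_marg_prod[OF assms(1), of k "\<lambda>l. if l \<in> {i} then (\<lambda>x. x) else (\<lambda>_. 1)"]
      one marg_moments(2) prod_if[of "{i}" k] by (auto simp: single)
  show "(\<integral>\<omega>. \<omega> i \<partial>law I) = 0"
    by (subst law_integral(2)[OF assms(1)]) (simp_all add: i1)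
  assume j: "j \<in> I" "i \<noteq> j"
  have double: "(\<Prod>l\<in>I. (if l = i \<or> l = j then (\<lambda>x. x) else (\<lambda>_. 1)) (x l)) = x i * x j" for x :: "_ \<Rightarrow> real"
    using assms j by (subst prod.mono_neutral_right[of I "{i, j}"]) auto
  have i2: "integrable (\<Pi>\<^sub>M l\<in>I. marg k) (\<lambda>\<omega>. \<omega> i * \<omega> j)" "(\<integral>\<omega>. \<omega> i * \<omega> j \<partial>(\<Pi>\<^sub>M l\<in>I. marg k)) = 0" for k
    using expectation_PiM_marg_prod[OF assms(1), of k "\<lambda>l. if l \<in> {i, j} then (\<lambda>x. x) else (\<lambda>_. 1)"]
      one marg_moments(2) prod_if[of "{i, j}" k] by (auto simp: double)
  show "(\<integral>\<omega>. \<omega> i * \<omega> j \<partial>law I) = 0"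
    by (subst law_integral(2)[OF assms(1)]) (simp_all add: i2)
qed

end

section \<open>Marginal law and p-values\<close>

lemma real_card_eq_sum:
  "finite I \<Longrightarrow> real (card {i \<in> I. P i}) = (\<Sum>i\<in>I. if P i then 1 else 0)"
  by (simp flip: sum.inter_filter)

context score_mixture
begin

lemma real_distribution_\<mu>: "real_distribution \<mu>"
  by (simp add: real_distribution_def real_distribution_axioms_def prob_space_\<mu>)

lemma measure_\<mu>_singleton: "measure \<mu> {x} = 0"
proof -
  have "AE y in lborel. y \<noteq> x" by (rule AE_lborel_singleton)
  then have "AE y in lborel. y \<in> {x} \<longrightarrow> ennreal (fbar y) = 0" by eventually_elim simp
  then have "{x} \<in> null_sets \<mu>"
    unfolding \<mu>_def by (subst null_sets_density_iff) simp_all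
  then show ?thesis by (simp add: measure_def null_setsD1)
qed

lemma isCont_cdf_\<mu>: "isCont (cdf \<mu>) x"
proof -
  interpret real_distribution \<mu> by (rule real_distribution_\<mu>)
  show ?thesis by (simp add: isCont_cdf measure_\<mu>_singleton)
qed

text \<open>As \<open>fbar\<close> is positive everywhere, an interval of
  \<open>\<mu>\<close>-measure zero would be Lebesgue null.\<close>

lemma strict_mono_cdf_\<mu>: "strict_mono (cdf \<mu>)"
proof (rule strict_monoI)
  fix x y :: real assume "x < y"
  interpret real_distribution \<mu> by (rule real_distribution_\<mu>)
  have "measure \<mu> {x<..y} \<noteq> 0"
  proof
    assume "measure \<mu> {x<..y} = 0"
    then have "{x<..y} \<in> null_sets \<mu>" by (simp add: emeasure_eq_measure null_setsI)
    then have "AE z in lborel. z \<in> {x<..y} \<longrightarrow> ennreal (fbar z) = 0"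
      unfolding \<mu>_def by (subst (asm) null_sets_density_iff) auto
    moreover have "ennreal (fbar z) \<noteq> 0" for z
      using fbar_pos[of z] by (simp add: ennreal_eq_0_iff not_le)
    ultimately have "AE z in lborel. z \<notin> {x<..y}" by simp
    then have "{x<..y} \<in> null_sets lborel" by (subst (asm) AE_iff_null_sets[symmetric]) auto
    then show False using \<open>x < y\<close> by (auto simp: null_sets_def)
  qed
  then show "cdf \<mu> x < cdf \<mu> y"
    using cdf_diff_eq[OF \<open>x < y\<close>] measure_nonneg[of \<mu> "{x<..y}"] by linarith
qed

lemma cdf_\<mu>_bounds: "0 < cdf \<mu> x" "cdf \<mu> x < 1"
proof -
  interpret real_distribution \<mu> by (rule real_distribution_\<mu>)
  have "cdf \<mu> (x - 1) < cdf \<mu> x" "cdf \<mu> x < cdf \<mu> (x + 1)"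
    using strict_mono_cdf_\<mu> by (simp_all add: strict_mono_less)
  moreover have "0 \<le> cdf \<mu> (x - 1)" by (rule cdf_nonneg)
  ultimately show "0 < cdf \<mu> x" "cdf \<mu> x < 1" using cdf_bounded_prob[of "x + 1"] by linarith+
qed

lemma cdf_\<mu>_uminus: "cdf \<mu> (- x) = 1 - cdf \<mu> x"
proof -
  interpret real_distribution \<mu> by (rule real_distribution_\<mu>)
  have "cdf \<mu> (- x) = measure (distr \<mu> borel uminus) {..- x}"
    by (simp add: distr_uminus_\<mu> cdf_def)
  also have "\<dots> = measure \<mu> {x..}"
    by (subst measure_distr) (auto intro!: arg_cong[where f = "measure \<mu>"])
  also have "\<dots> = 1 - measure \<mu> {..<x}"
    using prob_compl[of "{..<x}"] by (simp add: Compl_eq_Diff_UNIV[symmetric] not_less Compl_lessThan)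
  also have "measure \<mu> {..<x} = cdf \<mu> x"
  proof -
    have "measure \<mu> {..x} = measure \<mu> ({..<x} \<union> {x})"
      by (rule arg_cong[where f = "measure \<mu>"]) auto
    also have "\<dots> = measure \<mu> {..<x} + measure \<mu> {x}"
      by (rule finite_measure_Union) auto
    finally show ?thesis
      by (simp add: cdf_def measure_\<mu>_singleton)
  qed
  finally show ?thesis .
qed

lemma cdf_\<mu>_surj:
  assumes "0 < p" "p < 1" shows "\<exists>x. cdf \<mu> x = p"
proof -
  interpret real_distribution \<mu> by (rule real_distribution_\<mu>)
  have "\<forall>\<^sub>F x in at_bot. cdf \<mu> x < p"
    by (rule order_tendstoD(2)[OF cdf_lim_at_bot assms(1)])
  then obtain a where a: "cdf \<mu> a < p" by (auto simp: eventually_at_bot_linorder)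
  have "\<forall>\<^sub>F x in at_top. p < cdf \<mu> x"
    by (rule order_tendstoD(1)[OF cdf_lim_at_top_prob assms(2)])
  then obtain b where b: "p < cdf \<mu> b" by (auto simp: eventually_at_top_linorder)
  have "a < b" using a b strict_mono_less[OF strict_mono_cdf_\<mu>, of a b] by linarith
  then show ?thesis
    using IVT[of "cdf \<mu>" a p b] a b isCont_cdf_\<mu> by auto
qed

section \<open>The p-value transform\<close>

definition pval :: "real \<Rightarrow> real" where
  "pval x = 1 - cdf \<mu> x"

text \<open>The value 0 off the unit interval only makes the function total; the density of the
  p-values carries an indicator that vanishes there.\<close>

definition pval_inv :: "real \<Rightarrow> real" where
  "pval_inv p = (if p \<in> {0<..<1} then inv pval p else 0)"

lemma pval_in: "pval x \<in> {0<..<1}"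
  using cdf_\<mu>_bounds[of x] by (simp add: pval_def)

lemma pval_less_iff: "pval x < pval y \<longleftrightarrow> y < x"
  using strict_mono_less[OF strict_mono_cdf_\<mu>, of y x] by (simp add: pval_def)

lemma pval_le_iff: "pval x \<le> pval y \<longleftrightarrow> y \<le> x"
  using pval_less_iff[of y x] by (simp add: not_less[symmetric])

lemma inj_pval: "inj pval"
  by (rule injI) (metis pval_le_iff order_antisym order_refl)

lemma pval_inv_pval [simp]: "pval_inv (pval x) = x"
  unfolding pval_inv_def using pval_in[of x] inj_pval by simp

lemma pval_surj:
  assumes "p \<in> {0<..<1}" shows "\<exists>x. p = pval x"
proof -
  obtain x where "cdf \<mu> x = 1 - p" using cdf_\<mu>_surj[of "1 - p"] assms by auto
  then have "p = pval x" by (simp add: pval_def)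
  then show ?thesis ..
qed

lemma pval_measurable [measurable]: "pval \<in> borel_measurable borel"
proof -
  have "mono (cdf \<mu>)" using strict_mono_cdf_\<mu> by (rule strict_mono_mono)
  then have [measurable]: "cdf \<mu> \<in> borel_measurable borel" by (rule borel_measurable_mono)
  show ?thesis unfolding pval_def[abs_def] by measurable
qed

lemma pval_inv_measurable [measurable]: "pval_inv \<in> borel_measurable borel"
proof -
  have "mono_on {0<..<1} (\<lambda>p. - pval_inv p)"
  proof (rule mono_onI)
    fix r s :: real assume "r \<in> {0<..<1}" "s \<in> {0<..<1}" "r \<le> s"
    then show "- pval_inv r \<le> - pval_inv s"
      using pval_surj[of r] pval_surj[of s] by (auto simp: pval_le_iff)
  qed
  then have "(\<lambda>p. - pval_inv p) \<in> borel_measurable (restrict_space borel {0<..<1})"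
    by (rule borel_measurable_mono_on_fnc)
  then have "(\<lambda>p. if p \<in> {0<..<1} then - pval_inv p else 0) \<in> borel_measurable borel"
    by (subst (asm) measurable_restrict_space_iff[where c = 0]) auto
  then have "(\<lambda>p. - (if p \<in> {0<..<1} then - pval_inv p else 0)) \<in> borel_measurable borel"
    by (rule borel_measurable_uminus)
  also have "(\<lambda>p. - (if p \<in> {0<..<1} then - pval_inv p else 0)) = pval_inv"
    by (auto simp: pval_inv_def fun_eq_iff)
  finally show ?thesis .
qed

lemma distr_pval: "distr \<mu> borel pval = uniform_measure lborel {0<..<1}"
proof (rule cdf_unique)
  interpret real_distribution \<mu> by (rule real_distribution_\<mu>)
  show "real_distribution (distr \<mu> borel pval)"
    by (rule real_distribution_distr) (simp add: measurable_finite_borel)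
  interpret U: prob_space "uniform_measure lborel {0<..<1::real}"
    by (rule prob_space_uniform_measure) auto
  show "real_distribution (uniform_measure lborel {0<..<1})"
    by unfold_locales simp
  show "cdf (distr \<mu> borel pval) = cdf (uniform_measure lborel {0<..<1})"
  proof
    fix y :: real
    have *: "cdf (distr \<mu> borel pval) y = measure \<mu> {x. pval x \<le> y}"
      unfolding cdf_def by (subst measure_distr) (auto intro!: arg_cong[where f = "measure \<mu>"])
    have **: "cdf (uniform_measure lborel {0<..<1}) y = measure lborel ({0<..<1} \<inter> {..y})"
      unfolding cdf_def by (subst measure_uniform_measure) auto
    consider "y \<le> 0" | "1 \<le> y" | "y \<in> {0<..<1}" by fastforce
    then show "cdf (distr \<mu> borel pval) y = cdf (uniform_measure lborel {0<..<1}) y"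
    proof cases
      case 1
      have "pval x \<le> y \<longleftrightarrow> False" for x using pval_in[of x] 1 by auto
      moreover have "{0<..<1} \<inter> {..y} = {}" using 1 by auto
      ultimately show ?thesis unfolding * ** by simp
    next
      case 2
      have "pval x \<le> y \<longleftrightarrow> True" for x using pval_in[of x] 2 by auto
      moreover have "{0<..<1} \<inter> {..y} = {0<..<1}" using 2 by auto
      ultimately show ?thesis unfolding * ** using prob_space by simp
    next
      case 3
      then obtain x where x: "y = pval x" using pval_surj by blast
      \<comment> \<open>The event is an upper tail of \<open>\<mu>\<close>; by symmetry its mass
        equals that of the reflected lower tail, which is a value of the cdf.\<close>
      have "measure \<mu> {z. pval z \<le> y} = measure (distr \<mu> borel uminus) {x..}"
        unfolding x pval_le_iff distr_uminus_\<mu> by (simp add: atLeast_def)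
      also have "\<dots> = cdf \<mu> (- x)"
        unfolding cdf_def by (subst measure_distr) (auto intro!: arg_cong[where f = "measure \<mu>"])
      also have "\<dots> = y" by (simp add: cdf_\<mu>_uminus x pval_def)
      also have "y = measure lborel ({0<..<1} \<inter> {..y})"
      proof -
        have "{0<..<1} \<inter> {..y} = {0<..y}" using 3 by auto
        then show ?thesis using 3 by simp
      qed
      finally show ?thesis unfolding * ** .
    qed
  qed
qed

text \<open>No Jacobian is computed. The law of the scores has a density \<open>r\<close> relative
  to the product of its marginals; the coordinatewise transform \<open>\<tau>\<close> sends that
  product to the uniform law on the cube, and \<open>r\<close> is carried along as
  \<open>r'\<close>.\<close>

lemma joint_density_pval:
  fixes I :: "'i set"
  assumes "finite I"
  shows "has_joint_density_pos_on (law I) I (\<lambda>i \<omega>. pval (\<omega> i)) (\<Pi>\<^sub>E i\<in>I. {0<..<1})"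
proof -
  let ?L = "\<Pi>\<^sub>M i\<in>I. lborel :: real measure"
  have [measurable_cong]: "sets (\<Pi>\<^sub>M i\<in>I. \<mu>) = sets ?L"
    by (rule sets_PiM_cong) auto
  have [measurable_cong]: "sets (\<Pi>\<^sub>M i\<in>I. lborel) = sets (\<Pi>\<^sub>M i\<in>I. borel :: real measure)"
    by (rule sets_PiM_cong) auto
  define r where "r x = joint I x / (\<Prod>i\<in>I. fbar (x i))" for x
  define r' where "r' p = r (\<lambda>i\<in>I. pval_inv (p i))" for p
  define \<tau> where "\<tau> = (\<lambda>\<omega>::'i \<Rightarrow> real. \<lambda>i\<in>I. pval (\<omega> i))"
  define h where "h p = (\<Prod>i\<in>I. indicator {0<..<1} (p i)) * r' p" for p
  have [measurable]: "r \<in> borel_measurable ?L" unfolding r_def[abs_def] by measurable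
  have [measurable]: "(\<lambda>p. \<lambda>i\<in>I. pval_inv (p i)) \<in> measurable ?L ?L" by measurable
  have [measurable]: "r' \<in> borel_measurable ?L" unfolding r'_def[abs_def] by measurable
  have [measurable]: "\<tau> \<in> measurable ?L ?L" unfolding \<tau>_def by measurable
  have prod_pos: "0 < (\<Prod>i\<in>I. fbar (x i))" for x by (simp add: prod_pos fbar_pos)
  have r_pos: "0 < r x" for x unfolding r_def by (intro divide_pos_pos joint_pos prod_pos)
  have r'_pos: "0 < r' x" for x unfolding r'_def by (rule r_pos)
  have PiM_\<mu>: "(\<Pi>\<^sub>M i\<in>I. \<mu>) = density ?L (\<lambda>x. ennreal (\<Prod>i\<in>I. fbar (x i)))"
    unfolding \<mu>_def using prob_space_\<mu>
    by (intro PiM_density_lborel assms) (auto simp: less_imp_le[OF fbar_pos] \<mu>_def)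
  have law_eq: "law I = density (\<Pi>\<^sub>M i\<in>I. \<mu>) (\<lambda>x. ennreal (r x))"
    unfolding PiM_\<mu> law_def
    by (subst density_density_eq)
      (auto intro!: density_cong simp: r_def ennreal_mult[symmetric] less_imp_le[OF prod_pos]
        less_imp_le[OF joint_pos] less_imp_le[OF r_pos[unfolded r_def]] less_imp_neq[OF prod_pos, symmetric])
  \<comment> \<open>\<open>r\<close> reads only coordinates in \<open>I\<close>, where
    \<open>pval_inv\<close> undoes \<open>pval\<close>. Hence \<open>r\<close> factors through
    \<open>\<tau>\<close>, the shape that \<open>density_distr\<close> requires.\<close>
  have r_\<tau>: "r x = r' (\<tau> x)" for x
    unfolding r'_def \<tau>_def r_def joint_def by simp
  have U: "uniform_measure lborel {0<..<1::real} = density lborel (\<lambda>x. ennreal (indicator {0<..<1} x))"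
    unfolding uniform_measure_def
    by (intro density_cong) (auto split: split_indicator simp: divide_ennreal_def)
  have "prob_space (uniform_measure lborel {0<..<1::real})"
    by (rule prob_space_uniform_measure) auto
  then have PiM_U: "(\<Pi>\<^sub>M i\<in>I. uniform_measure lborel {0<..<1}) =
      density ?L (\<lambda>x. ennreal (\<Prod>i\<in>I. indicator {0<..<1} (x i)))"
    unfolding U by (intro PiM_density_lborel assms) auto
  have distr_\<tau>: "distr (\<Pi>\<^sub>M i\<in>I. \<mu>) ?L \<tau> = (\<Pi>\<^sub>M i\<in>I. uniform_measure lborel {0<..<1})"
  proof -
    have "distr (\<Pi>\<^sub>M i\<in>I. \<mu>) ?L \<tau> = distr (\<Pi>\<^sub>M i\<in>I. \<mu>) (\<Pi>\<^sub>M i\<in>I. \<mu>) (compose I pval)"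
      by (rule distr_cong) (auto simp: \<tau>_def compose_def intro!: sets_PiM_cong)
    also have "\<dots> = (\<Pi>\<^sub>M i\<in>I. distr \<mu> \<mu> pval)"
      using prob_space_\<mu> by (intro distr_PiM_finite_prob_space' assms) auto
    also have "distr \<mu> \<mu> pval = distr \<mu> borel pval" by (rule distr_cong) auto
    finally show ?thesis unfolding distr_pval .
  qed
  have "distr (law I) ?L \<tau> = distr (density (\<Pi>\<^sub>M i\<in>I. \<mu>) (\<lambda>x. ennreal (r' (\<tau> x)))) ?L \<tau>"
    unfolding law_eq r_\<tau> ..
  also have "\<dots> = density (distr (\<Pi>\<^sub>M i\<in>I. \<mu>) ?L \<tau>) (\<lambda>x. ennreal (r' x))"
    by (rule density_distr[symmetric]) measurable
  also have "\<dots> = density ?L (\<lambda>x. ennreal (h x))"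
    unfolding distr_\<tau> PiM_U
    by (subst density_density_eq)
      (auto intro!: density_cong simp: h_def ennreal_mult[symmetric] less_imp_le[OF r'_pos] prod_nonneg)
  finally have "distributed (law I) ?L \<tau> (\<lambda>x. ennreal (h x))"
    unfolding distributed_def h_def by simp
  moreover have "0 \<le> h x" for x
    unfolding h_def by (intro mult_nonneg_nonneg prod_nonneg less_imp_le[OF r'_pos]) auto
  moreover have "0 < h x" if "x \<in> (\<Pi>\<^sub>E i\<in>I. {0<..<1})" for x
  proof -
    have "(\<Prod>i\<in>I. indicator {0<..<1} (x i)) = (1 :: real)"
      using PiE_mem[OF that] by (intro prod.neutral) (simp add: indicator_def)
    then show ?thesis by (simp add: h_def r'_pos)
  qed
  ultimately show ?thesis
    unfolding has_joint_density_pos_on_def \<tau>_def by blast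
qed

lemma FDR_knockoff:
  assumes "finite I" "q < 1"
  shows "FDR (law I) I (\<lambda>\<omega>. knockoff_rejections q I (\<lambda>i. \<omega> i)) =
    (\<integral>\<omega>. (if knockoff_admissible q I \<omega> = {} then 0 else 1) \<partial>law I)"
  by (subst FDR_all_null[OF assms(1)])
    (auto simp: knockoff_rejections_def[of q I] simp flip: knockoff_rejections_eq_empty_iff[OF assms])

text \<open>Both rates are probabilities of rejecting anything at all, so it suffices that the two
  procedures reject something at the same sample points.\<close>

lemma FDR_mirror:
  assumes "finite I" "q < 1" and p: "\<And>i \<omega>. i \<in> I \<Longrightarrow> p i \<omega> = pval (\<omega> i)"
  shows "FDR (law I) I (\<lambda>\<omega>. mirror_rejections q I (\<lambda>i. p i \<omega>)) =
    FDR (law I) I (\<lambda>\<omega>. knockoff_rejections q I (\<lambda>i. \<omega> i))"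
proof -
  have "mirror_rejections q I (\<lambda>i. p i \<omega>) = {} \<longleftrightarrow> knockoff_admissible q I \<omega> = {}" for \<omega>
  proof -
    have "mirror_rejections q I (\<lambda>i. p i \<omega>) = {} \<longleftrightarrow> mirror_admissible q I (\<lambda>i. p i \<omega>) = {}"
      using pval_in by (intro mirror_rejections_eq_empty_iff assms(1,2)) (simp add: p)
    also have "\<dots> \<longleftrightarrow> knockoff_admissible q I \<omega> = {}"
      by (rule mirror_admissible_empty_iff[OF assms(1,2) strict_mono_cdf_\<mu> cdf_\<mu>_uminus cdf_\<mu>_bounds(2)])
        (simp add: p pval_def)
    finally show ?thesis .
  qed
  then have "FDR (law I) I (\<lambda>\<omega>. mirror_rejections q I (\<lambda>i. p i \<omega>)) =
      (\<integral>\<omega>. (if knockoff_admissible q I \<omega> = {} then 0 else 1) \<partial>law I)"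
    by (subst FDR_all_null[OF assms(1)]) (auto simp: mirror_rejections_def)
  then show ?thesis by (simp add: FDR_knockoff[OF assms(1,2)])
qed

end

section \<open>Probability of a rejection within one scenario\<close>

lemma knockoff_admissible_measurable:
  assumes [simp]: "finite I" and "q < 1"
  shows "{\<omega> \<in> space (\<Pi>\<^sub>M i\<in>I. borel). knockoff_admissible q I \<omega> \<noteq> {}} \<in> sets (\<Pi>\<^sub>M i\<in>I. borel)"
proof -
  let ?B = "\<Pi>\<^sub>M i\<in>I. borel :: real measure"
  have m: "(\<lambda>\<omega>. real (N_minus I \<omega> \<bar>\<omega> i\<bar>)) \<in> borel_measurable ?B"
      "(\<lambda>\<omega>. real (N_plus I \<omega> \<bar>\<omega> i\<bar>)) \<in> borel_measurable ?B" if [measurable]: "i \<in> I" for i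
    unfolding N_plus_def N_minus_def real_card_eq_sum[OF assms(1)] by measurable
  \<comment> \<open>The data-dependent grid is replaced by a finite union over the index whose
    magnitude is tried as threshold.\<close>
  have "{\<omega> \<in> space ?B. knockoff_admissible q I \<omega> \<noteq> {}} = (\<Union>i\<in>I. {\<omega> \<in> space ?B.
      1 + real (N_minus I \<omega> \<bar>\<omega> i\<bar>) \<le> q * real (N_plus I \<omega> \<bar>\<omega> i\<bar>)})"
    unfolding knockoff_admissible_nonempty_iff[OF assms] by auto
  also have "\<dots> \<in> sets ?B"
    by (intro sets.finite_UN assms(1) borel_measurable_le borel_measurable_add borel_measurable_times
      borel_measurable_const m)
  finally show ?thesis .
qed

text \<open>One fixed cut \<open>s\<close> with positive drift is enough, since any cut that passes
  the inequality yields an admissible grid point. Hoeffding's inequality controls the failure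
  probability.\<close>

lemma knockoff_power:
  fixes \<nu> :: "real measure" and s :: real
  assumes \<nu>: "prob_space \<nu>" and sets_\<nu>[measurable_cong]: "sets \<nu> = sets borel"
    and q: "0 < q" "q < 1" and s: "0 \<le> s"
    and drift: "measure \<nu> {..- s} < q * measure \<nu> {s..}" and \<delta>: "0 < \<delta>"
  shows "\<forall>\<^sub>F m in sequentially. 1 - \<delta> \<le> measure (\<Pi>\<^sub>M i\<in>{1..m}. \<nu>)
    {\<omega> \<in> space (\<Pi>\<^sub>M i\<in>{1..m}. borel). knockoff_admissible q {1..m} \<omega> \<noteq> {}}"
proof -
  interpret \<nu>: prob_space \<nu> by (rule \<nu>)
  \<comment> \<open>Summed over the sample, \<open>Y\<close> gives \<open>q\<close> times
    \<open>N_plus\<close> minus \<open>N_minus\<close> at \<open>s\<close>; the cut passes exactly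
    when this sum is at least 1.\<close>
  define Y where "Y x = q * indicator {s..} x - indicator {..- s} x" for x :: real
  have Y_eq: "Y x = q * (if s \<le> x then 1 else 0) - (if x \<le> - s then 1 else 0)" for x
    by (simp add: Y_def indicator_def)
  define d where "d = q * measure \<nu> {s..} - measure \<nu> {..- s}"
  have d: "0 < d" using drift by (simp add: d_def)
  have [measurable]: "Y \<in> borel_measurable borel" unfolding Y_def[abs_def] by measurable
  have space_\<nu>: "space \<nu> = UNIV" using sets_eq_imp_space_eq[OF sets_\<nu>] by simp
  have EY: "(\<integral>x. Y x \<partial>\<nu>) = d"
  proof -
    have "integrable \<nu> (indicator A :: real \<Rightarrow> real)" if "A \<in> sets borel" for A
      using that sets_\<nu> by (intro \<nu>.integrable_const_bound[where B = 1]) (auto simp: indicator_def)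
    then show ?thesis unfolding Y_def d_def by (simp add: space_\<nu>)
  qed
  \<comment> \<open>This is Hoeffding's bound for a sum of variables in [-1, 1] falling short of its
    mean m d by m d / 2. The second condition below lets the other half of the mean cover the
    1.\<close>
  have "(\<lambda>m. exp (- (real m * d\<^sup>2 / 8))) \<longlonglongrightarrow> 0"
    using d by real_asymp
  then have "\<forall>\<^sub>F m in sequentially. exp (- (real m * d\<^sup>2 / 8)) < \<delta>"
    using \<delta> by (rule order_tendstoD)
  moreover have "\<forall>\<^sub>F m in sequentially. 1 \<le> real m * d / 2"
    using d by real_asymp
  moreover have "\<forall>\<^sub>F m in sequentially. 1 \<le> (m :: nat)" by (rule eventually_ge_at_top)
  ultimately show ?thesis
  proof eventually_elim
    case (elim m)
    let ?I = "{1..m}" and ?P = "\<Pi>\<^sub>M i\<in>{1..m}. \<nu>"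
    let ?E = "{\<omega> \<in> space (\<Pi>\<^sub>M i\<in>?I. borel). knockoff_admissible q ?I \<omega> \<noteq> {}}"
    interpret P: prob_space ?P by (intro prob_space_PiM \<nu>)
    have comp: "distr ?P borel (\<lambda>\<omega>. \<omega> i) = \<nu>" if "i \<in> ?I" for i
    proof -
      have "distr ?P borel (\<lambda>\<omega>. \<omega> i) = distr ?P \<nu> (\<lambda>\<omega>. \<omega> i)"
        by (rule distr_cong) (simp_all add: sets_\<nu>)
      also have "\<dots> = \<nu>" using that \<nu> by (intro distr_PiM_component) auto
      finally show ?thesis .
    qed
    have sets_P[measurable_cong]: "sets ?P = sets (\<Pi>\<^sub>M i\<in>?I. borel)"
      by (rule sets_PiM_cong) (simp_all add: sets_\<nu>)
    have indep0: "P.indep_vars (\<lambda>_. borel) (\<lambda>i \<omega>. \<omega> i) ?I"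
    proof (subst P.indep_vars_iff_distr_eq_PiM')
      show "?I \<noteq> {}" using elim by simp
      have "distr ?P (\<Pi>\<^sub>M i\<in>?I. borel) (\<lambda>\<omega>. \<lambda>i\<in>?I. \<omega> i) = distr ?P ?P (\<lambda>\<omega>. \<omega>)"
        by (rule distr_cong) (auto simp: sets_P space_PiM PiE_iff restrict_def extensional_def fun_eq_iff
          simp del: One_nat_def)
      also have "\<dots> = (\<Pi>\<^sub>M i\<in>?I. distr ?P borel (\<lambda>\<omega>. \<omega> i))"
        unfolding distr_id2[OF refl] by (rule PiM_cong[OF refl comp[symmetric]])
      finally show "distr ?P (\<Pi>\<^sub>M i\<in>?I. borel) (\<lambda>\<omega>. \<lambda>i\<in>?I. \<omega> i) = (\<Pi>\<^sub>M i\<in>?I. distr ?P borel (\<lambda>\<omega>. \<omega> i))" .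
    qed simp
    have Y_m: "(\<lambda>\<omega>. Y (\<omega> i)) \<in> borel_measurable ?P" if "i \<in> ?I" for i
      using that by measurable
    have distrY: "distr ?P borel (\<lambda>\<omega>. Y (\<omega> i)) = distr \<nu> borel Y" if "i \<in> ?I" for i
    proof -
      have "distr ?P borel (\<lambda>\<omega>. Y (\<omega> i)) = distr (distr ?P borel (\<lambda>\<omega>. \<omega> i)) borel Y"
        using that by (subst distr_distr) (auto simp: o_def)
      then show ?thesis using comp[OF that] by simp
    qed
    have one: "1 \<in> ?I" using elim by simp
    interpret H: Hoeffding_ineq_iid ?P ?I "\<lambda>i \<omega>. Y (\<omega> i)" "\<lambda>\<omega>. Y (\<omega> 1)" "-1" 1 "P.expectation (\<lambda>\<omega>. Y (\<omega> 1))"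
    proof unfold_locales
      show "P.indep_vars (\<lambda>_. borel) (\<lambda>i \<omega>. Y (\<omega> i)) ?I"
        by (rule P.indep_vars_compose2[OF indep0]) simp
      show "(\<lambda>\<omega>. Y (\<omega> 1)) \<in> borel_measurable ?P" using Y_m[OF one] .
      show "AE \<omega> in ?P. Y (\<omega> 1) \<in> {- 1..1}"
        using q by (intro AE_I2) (auto simp: Y_def indicator_def)
      show "distr ?P borel (\<lambda>\<omega>. Y (\<omega> i)) = distr ?P borel (\<lambda>\<omega>. Y (\<omega> 1))" if "i \<in> ?I" for i
        unfolding distrY[OF that] distrY[OF one] ..
    qed simp_all
    have mean: "P.expectation (\<lambda>\<omega>. Y (\<omega> 1)) = d"
    proof -
      have "P.expectation (\<lambda>\<omega>. Y (\<omega> 1)) = (\<integral>x. Y x \<partial>distr ?P borel (\<lambda>\<omega>. \<omega> 1))"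
        using one by (subst integral_distr) auto
      then show ?thesis unfolding comp[OF one] EY .
    qed
    have E_P: "?E \<in> P.events"
      unfolding sets_P by (rule knockoff_admissible_measurable) (use q in auto)
    have "1 - P.prob ?E = P.prob (space ?P - ?E)"
      using E_P by (rule P.prob_compl[symmetric])
    also have "\<dots> \<le> P.prob {\<omega> \<in> space ?P. (\<Sum>i\<in>?I. Y (\<omega> i)) \<le> real (card ?I) * P.expectation (\<lambda>\<omega>. Y (\<omega> 1)) - real m * d / 2}"
    proof (intro P.finite_measure_mono subsetI)
      fix \<omega> assume \<omega>: "\<omega> \<in> space ?P - ?E"
      have "(\<Sum>i\<in>?I. Y (\<omega> i)) = q * real (N_plus ?I \<omega> s) - real (N_minus ?I \<omega> s)"
        unfolding N_plus_def N_minus_def real_card_eq_sum[OF finite_atLeastAtMost] Y_eq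
          sum_subtractf sum_distrib_left ..
      moreover have "\<not> 1 + real (N_minus ?I \<omega> s) \<le> q * real (N_plus ?I \<omega> s)"
        using knockoff_admissible_nonempty[OF _ q(2) s, of ?I \<omega>] \<omega>
        by (auto simp: space_PiM space_\<nu>)
      \<comment> \<open>Failure at \<open>s\<close> leaves the sum below 1, and 1 <= m d / 2 by the
        choice of \<open>m\<close>.\<close>
      ultimately have "(\<Sum>i\<in>?I. Y (\<omega> i)) \<le> real m * d / 2" using elim by linarith
      then show "\<omega> \<in> {\<omega> \<in> space ?P. (\<Sum>i\<in>?I. Y (\<omega> i)) \<le> real (card ?I) * P.expectation (\<lambda>\<omega>. Y (\<omega> 1)) - real m * d / 2}"
        using \<omega> unfolding mean by (simp add: mult.commute)
    next
      show "{\<omega> \<in> space ?P. (\<Sum>i\<in>?I. Y (\<omega> i)) \<le> real (card ?I) * P.expectation (\<lambda>\<omega>. Y (\<omega> 1)) - real m * d / 2} \<in> P.events"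
        by measurable
    qed
    also have "\<dots> \<le> exp (- 2 * (real m * d / 2)\<^sup>2 / (real (card ?I) * (1 - (- 1))\<^sup>2))"
      using d elim by (intro H.Hoeffding_ineq_le) auto
    also have "\<dots> = exp (- (real m * d\<^sup>2 / 8))"
      using elim by (simp add: power2_eq_square field_simps)
    also have "\<dots> < \<delta>" using elim by simp
    finally show ?case by simp
  qed
qed

text \<open>The scenarios below \<open>n\<close> each carry weight 1 / (n + 1); scenario
  \<open>n\<close> is bounded below by 0.\<close>

lemma (in score_mixture) FDR_knockoff_ge:
  assumes "finite I" "q < 1"
    and good: "\<And>k. k < n \<Longrightarrow> 1 - \<delta> \<le> measure (\<Pi>\<^sub>M i\<in>I. marg k)
      {\<omega> \<in> space (\<Pi>\<^sub>M i\<in>I. borel). knockoff_admissible q I \<omega> \<noteq> {}}"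
  shows "real n * (1 - \<delta>) / real (Suc n) \<le> FDR (law I) I (\<lambda>\<omega>. knockoff_rejections q I (\<lambda>i. \<omega> i))"
proof -
  let ?E = "{\<omega> \<in> space (\<Pi>\<^sub>M i\<in>I. borel). knockoff_admissible q I \<omega> \<noteq> {}}"
  have E: "?E \<in> sets (\<Pi>\<^sub>M i\<in>I. marg k)" for k
    using knockoff_admissible_measurable[OF assms(1,2)] by simp
  have int: "integrable (\<Pi>\<^sub>M i\<in>I. marg k) (indicator ?E :: _ \<Rightarrow> real)" for k
  proof -
    interpret prob_space "\<Pi>\<^sub>M i\<in>I. marg k" by (rule prob_space_PiM_marg)
    show ?thesis using E[of k] by (intro integrable_const_bound[where B = 1]) (auto simp: indicator_def)
  qed
  have "real n * (1 - \<delta>) \<le> (\<Sum>k<n. measure (\<Pi>\<^sub>M i\<in>I. marg k) ?E)"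
    using sum_mono[of "{..<n}" "\<lambda>_. 1 - \<delta>"] good by simp
  also have "\<dots> \<le> (\<Sum>k\<le>n. measure (\<Pi>\<^sub>M i\<in>I. marg k) ?E)"
    by (intro sum_mono2) auto
  finally have "real n * (1 - \<delta>) / real (Suc n) \<le> (\<Sum>k\<le>n. measure (\<Pi>\<^sub>M i\<in>I. marg k) ?E) / real (Suc n)"
    by (intro divide_right_mono) auto
  also have "\<dots> = (\<Sum>k\<le>n. \<integral>\<omega>. indicator ?E \<omega> \<partial>(\<Pi>\<^sub>M i\<in>I. marg k)) / real (Suc n)"
    using E sets.Int_space_eq2[OF E] by (simp del: of_nat_Suc)
  also have "\<dots> = (\<integral>\<omega>. indicator ?E \<omega> \<partial>law I)"
    by (rule law_integral(2)[OF assms(1) int, symmetric])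
  also have "\<dots> = (\<integral>\<omega>. (if knockoff_admissible q I \<omega> = {} then 0 else 1) \<partial>law I)"
    by (intro Bochner_Integration.integral_cong) (auto simp: space_PiM)
  finally show ?thesis unfolding FDR_knockoff[OF assms(1,2)] .
qed

section \<open>The cyclic dyadic mixture\<close>

lemma four_power: "(4 :: real) ^ j = 2 ^ j * 2 ^ j"
  by (simp flip: power_mult_distrib)

text \<open>Blocks are closed, so neighbours share an endpoint; this null set has to be discarded in
  tail estimates.\<close>

definition dyadic :: "nat \<Rightarrow> real \<Rightarrow> real" where
  "dyadic j x = indicator {2 ^ j..2 ^ Suc j} x / 4 ^ j"

lemma dyadic_measurable [measurable]: "dyadic j \<in> borel_measurable borel"
  unfolding dyadic_def[abs_def] by measurable

lemma dyadic_nonneg: "0 \<le> dyadic j x"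
  by (simp add: dyadic_def)

lemma dyadic_moment0: "has_bochner_integral lborel (dyadic j) (1 / 2 ^ j)"
proof -
  have "has_bochner_integral lborel (\<lambda>x::real. indicator {2 ^ j..2 ^ Suc j} x) (measure lborel {2 ^ j..2 ^ Suc j :: real})"
    by (intro has_bochner_integral_real_indicator) auto
  then have "has_bochner_integral lborel (dyadic j) (measure lborel {2 ^ j..2 ^ Suc j :: real} / 4 ^ j)"
    unfolding dyadic_def[abs_def] by (rule has_bochner_integral_divide_zero)
  moreover have "measure lborel {2 ^ j..2 ^ Suc j :: real} / 4 ^ j = 1 / 2 ^ j"
    by (simp add: four_power)
  ultimately show ?thesis by simp
qed

text \<open>The weight \<open>1 / 4 ^ j\<close> makes the first moment independent of \<open>j\<close>.\<close>

lemma dyadic_moment1: "has_bochner_integral lborel (\<lambda>x. dyadic j x * x) (3 / 2)"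
proof -
  have "has_bochner_integral lborel (\<lambda>x. x ^ 1 * indicator {2 ^ j..2 ^ Suc j} x) (((2 ^ Suc j) ^ Suc 1 - (2 ^ j) ^ Suc 1) / Suc 1 :: real)"
    unfolding has_bochner_integral_iff
    by (intro conjI borel_integrable_atLeastAtMost integral_power) auto
  then have "has_bochner_integral lborel (\<lambda>x. x ^ 1 * indicator {2 ^ j..2 ^ Suc j} x / 4 ^ j)
      (((2 ^ Suc j) ^ Suc 1 - (2 ^ j) ^ Suc 1) / Suc 1 / 4 ^ j :: real)"
    by (rule has_bochner_integral_divide_zero)
  moreover have "((2 ^ Suc j) ^ Suc 1 - (2 ^ j) ^ Suc 1) / Suc 1 / 4 ^ j = (3 / 2 :: real)"
    by (simp add: power2_eq_square four_power field_simps)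
  ultimately have "has_bochner_integral lborel (\<lambda>x::real. x ^ 1 * indicator {2 ^ j..2 ^ Suc j} x / 4 ^ j) (3 / 2)"
    by (simp only:)
  then show ?thesis by (simp add: dyadic_def mult_ac)
qed

lemma dyadic_moment2: "integrable lborel (\<lambda>x. dyadic j x * x\<^sup>2)"
proof -
  have "integrable lborel (\<lambda>x::real. x ^ 2 * indicator {2 ^ j..2 ^ Suc j} x / 4 ^ j)"
    by (intro integrable_divide borel_integrable_atLeastAtMost) simp
  then show ?thesis by (simp add: dyadic_def mult_ac)
qed

lemma has_bochner_integral_reflect:
  fixes g :: "real \<Rightarrow> real"
  assumes "has_bochner_integral lborel g a"
  shows "has_bochner_integral lborel (\<lambda>x. g (- x)) a"
  using lborel_has_bochner_integral_real_affine_iff[of "-1" g a 0] assms by simp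

text \<open>The mass left for the Gaussian by two blocks of masses \<open>1 / 2 ^ j\<close> and
  \<open>1 / 2 ^ k\<close>, each scaled by 1/4.\<close>

definition weight :: "nat \<Rightarrow> nat \<Rightarrow> real" where
  "weight j k = 1 - (1 / 2 ^ j + 1 / 2 ^ k) / 4"

text \<open>The factor 1/4 keeps the two blocks below total mass 1/2, so the Gaussian weight stays
  positive. All blocks share one first moment, so every pair \<open>j\<close>, \<open>k\<close>
  gives mean zero.\<close>

definition bump :: "real \<Rightarrow> nat \<Rightarrow> nat \<Rightarrow> real \<Rightarrow> real" where
  "bump \<sigma> j k x = (dyadic j x + dyadic k (- x)) / 4 + weight j k * normal_density 0 \<sigma> x"

lemma weight_bounds: "1 / 2 \<le> weight j k" "weight j k \<le> 1"
proof -
  have bounds: "1 / 2 \<le> 1 - (a + b) / 4 \<and> 1 - (a + b) / 4 \<le> 1"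
    if "0 \<le> a" "a \<le> 1" "0 \<le> b" "b \<le> 1" for a b :: real
    using that by auto
  show "1 / 2 \<le> weight j k" "weight j k \<le> 1"
    using bounds[of "1 / 2 ^ j" "1 / 2 ^ k"] by (simp_all add: weight_def)
qed

lemma bump_measurable [measurable]: "bump \<sigma> j k \<in> borel_measurable borel"
  unfolding bump_def[abs_def] by measurable

lemma bump_pos: "0 < \<sigma> \<Longrightarrow> 0 < bump \<sigma> j k x"
  unfolding bump_def using weight_bounds(1)[of j k] normal_density_pos[of \<sigma> 0 x]
  by (intro add_nonneg_pos mult_pos_pos) (auto simp: dyadic_nonneg)

lemma bump_moment0:
  assumes "0 < \<sigma>" shows "has_bochner_integral lborel (bump \<sigma> j k) 1"
proof -
  have "has_bochner_integral lborel (normal_density 0 \<sigma>) 1"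
    using assms by (simp add: has_bochner_integral_iff)
  then have "has_bochner_integral lborel (bump \<sigma> j k) ((1 / 2 ^ j + 1 / 2 ^ k) / 4 + weight j k * 1)"
    unfolding bump_def[abs_def]
    by (intro has_bochner_integral_add has_bochner_integral_divide_zero has_bochner_integral_mult_right
      has_bochner_integral_reflect dyadic_moment0)
  then show ?thesis by (simp add: weight_def)
qed

lemma bump_moment1:
  assumes "0 < \<sigma>" shows "has_bochner_integral lborel (\<lambda>x. bump \<sigma> j k x * x) 0"
proof -
  have "has_bochner_integral lborel (\<lambda>x. normal_density 0 \<sigma> x * x) 0"
    using normal_moment_nz_1[OF assms] .
  then have "has_bochner_integral lborel
      (\<lambda>x. (dyadic j x * x - dyadic k (- x) * (- x)) / 4 + weight j k * (normal_density 0 \<sigma> x * x))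
      ((3 / 2 - 3 / 2) / 4 + weight j k * 0)"
    by (intro has_bochner_integral_add has_bochner_integral_diff has_bochner_integral_divide_zero
      has_bochner_integral_mult_right has_bochner_integral_reflect[of "\<lambda>x. dyadic k x * x"] dyadic_moment1)
  moreover have "(\<lambda>x. (dyadic j x * x - dyadic k (- x) * (- x)) / 4 + weight j k * (normal_density 0 \<sigma> x * x)) =
      (\<lambda>x. bump \<sigma> j k x * x)"
    by (simp add: bump_def fun_eq_iff algebra_simps add_divide_distrib)
  ultimately show ?thesis by simp
qed

lemma bump_moment2:
  assumes "0 < \<sigma>" shows "integrable lborel (\<lambda>x. bump \<sigma> j k x * x\<^sup>2)"
proof -
  have "integrable lborel (\<lambda>x. dyadic k (- x) * x\<^sup>2)"
    using has_bochner_integral_reflect[OF has_bochner_integral_integrable[OF dyadic_moment2[of k]]]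
    by (simp add: has_bochner_integral_iff)
  moreover have "integrable lborel (\<lambda>x. normal_density 0 \<sigma> x * x\<^sup>2)"
    using integrable_normal_moment[OF assms, of 0 2] by simp
  ultimately have "integrable lborel (\<lambda>x. (dyadic j x * x\<^sup>2 + dyadic k (- x) * x\<^sup>2) / 4 + weight j k * (normal_density 0 \<sigma> x * x\<^sup>2))"
    using dyadic_moment2[of j] by auto
  moreover have "(\<lambda>x. (dyadic j x * x\<^sup>2 + dyadic k (- x) * x\<^sup>2) / 4 + weight j k * (normal_density 0 \<sigma> x * x\<^sup>2)) =
      (\<lambda>x. bump \<sigma> j k x * x\<^sup>2)"
    by (simp add: bump_def fun_eq_iff algebra_simps add_divide_distrib)
  ultimately show ?thesis by simp
qed

lemma measure_density_eq:
  fixes g :: "real \<Rightarrow> real"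
  assumes g: "integrable lborel g" "\<And>x. 0 \<le> g x" and A: "A \<in> sets borel"
  shows "measure (density lborel (\<lambda>x. ennreal (g x))) A = (\<integral>x. g x * indicator A x \<partial>lborel)"
proof -
  have [measurable]: "g \<in> borel_measurable borel" using borel_measurable_integrable[OF g(1)] by simp
  have "measure (density lborel (\<lambda>x. ennreal (g x))) A = (\<integral>x. indicator A x \<partial>density lborel (\<lambda>x. ennreal (g x)))"
    using A by simp
  also have "\<dots> = (\<integral>x. g x * indicator A x \<partial>lborel)"
    using A g by (subst integral_density) auto
  finally show ?thesis .
qed

lemma bump_upper_tail:
  assumes "0 < \<sigma>"
  shows "1 / (4 * 2 ^ j) \<le> measure (density lborel (\<lambda>x. ennreal (bump \<sigma> j k x))) {2 ^ j..}"
proof -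
  have int: "integrable lborel (bump \<sigma> j k)"
    using bump_moment0[OF assms] by (rule integrable.intros)
  have "1 / (4 * 2 ^ j) = (\<integral>x. dyadic j x / 4 \<partial>lborel)"
    using dyadic_moment0[of j] by (simp add: has_bochner_integral_iff)
  also have "\<dots> \<le> (\<integral>x. bump \<sigma> j k x * indicator {2 ^ j..} x \<partial>lborel)"
  proof (rule integral_mono)
    show "integrable lborel (\<lambda>x. dyadic j x / 4)"
      using dyadic_moment0[of j] by (simp add: has_bochner_integral_iff)
    show "integrable lborel (\<lambda>x. bump \<sigma> j k x * indicator {2 ^ j..} x)"
      using int by (intro integrable_real_mult_indicator) auto
    fix x
    show "dyadic j x / 4 \<le> bump \<sigma> j k x * indicator {2 ^ j..} x"
    proof (cases "2 ^ j \<le> x")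
      case True
      have "0 \<le> weight j k * normal_density 0 \<sigma> x"
        using weight_bounds(1)[of j k] by (intro mult_nonneg_nonneg) auto
      with True show ?thesis using dyadic_nonneg[of k "- x"] by (simp add: bump_def add_divide_distrib)
    next
      case False
      then show ?thesis by (simp add: dyadic_def)
    qed
  qed
  also have "\<dots> = measure (density lborel (\<lambda>x. ennreal (bump \<sigma> j k x))) {2 ^ j..}"
    using less_imp_le[OF bump_pos[OF assms]] by (intro measure_density_eq[symmetric] int) auto
  finally show ?thesis .
qed

text \<open>For \<open>k < j\<close> the reflected block ends before the tail begins, up to one
  point. Only the Gaussian remains, and since 1 <= x^2 there, its tail is at most its second moment,
  as in Chebyshev's inequality.\<close>

lemma bump_lower_tail:
  assumes "0 < \<sigma>" "k < j"
  shows "measure (density lborel (\<lambda>x. ennreal (bump \<sigma> j k x))) {..- (2 ^ j)} \<le> \<sigma>\<^sup>2"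
proof -
  have int: "integrable lborel (bump \<sigma> j k)"
    using bump_moment0[OF assms(1)] by (rule integrable.intros)
  have 2: "has_bochner_integral lborel (\<lambda>x. normal_density 0 \<sigma> x * x\<^sup>2) (\<sigma>\<^sup>2)"
    using normal_moment_even[OF assms(1), of 0 1] by (simp add: numeral_2_eq_2)
  \<comment> \<open>When j = k + 1 the reflected block still touches the tail at this point.\<close>
  have "AE x in lborel. x \<noteq> - (2 ^ j :: real)" by (rule AE_lborel_singleton)
  then have ae: "AE x in lborel. bump \<sigma> j k x * indicator {..- (2 ^ j)} x \<le> normal_density 0 \<sigma> x * x\<^sup>2"
  proof eventually_elim
    case (elim x)
    show ?case
    proof (cases "x \<le> - (2 ^ j)")
      case True
      have "(2 :: real) ^ Suc k \<le> 2 ^ j" using assms(2) by (intro power_increasing) auto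
      moreover have "1 \<le> - x"
        using True one_le_power[of "2 :: real" j] by linarith
      ultimately have "dyadic k (- x) = 0" "1 \<le> x\<^sup>2" "dyadic j x = 0"
        using True elim power_mono[of 1 "- x" 2] by (auto simp: dyadic_def indicator_def)
      then show ?thesis
        using True weight_bounds[of j k] normal_density_pos[OF assms(1), of 0 x]
          mult_mono[of "weight j k" 1 "normal_density 0 \<sigma> x" "normal_density 0 \<sigma> x * x\<^sup>2"]
        by (auto simp: bump_def)
    next
      case False
      then show ?thesis using normal_density_pos[OF assms(1), of 0 x] by simp
    qed
  qed
  have "measure (density lborel (\<lambda>x. ennreal (bump \<sigma> j k x))) {..- (2 ^ j)} =
      (\<integral>x. bump \<sigma> j k x * indicator {..- (2 ^ j)} x \<partial>lborel)"
    using less_imp_le[OF bump_pos[OF assms(1)]] by (intro measure_density_eq int) auto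
  also have "\<dots> \<le> (\<integral>x. normal_density 0 \<sigma> x * x\<^sup>2 \<partial>lborel)"
    using 2 int ae by (intro integral_mono_AE integrable_real_mult_indicator) (auto simp: has_bochner_integral_iff)
  also have "\<dots> = \<sigma>\<^sup>2" using 2 by (simp add: has_bochner_integral_iff)
  finally show ?thesis .
qed

lemma score_mixture_bump:
  assumes "0 < \<sigma>"
  shows "score_mixture n (\<lambda>k. bump \<sigma> (if k = n then 0 else Suc k) k)"
proof
  fix k :: nat and x :: real
  let ?f = "bump \<sigma> (if k = n then 0 else Suc k) k"
  show "?f \<in> borel_measurable borel" by measurable
  show "0 < ?f x" by (rule bump_pos[OF assms])
  show "(\<integral>\<^sup>+x. ennreal (?f x) \<partial>lborel) = 1"
    using bump_moment0[OF assms, of "if k = n then 0 else Suc k" k] less_imp_le[OF bump_pos[OF assms]]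
    by (subst nn_integral_eq_integral) (auto simp: has_bochner_integral_iff)
  show "integrable lborel (\<lambda>x. ?f x * x\<^sup>2)" by (rule bump_moment2[OF assms])
  show "(\<integral>x. ?f x * x \<partial>lborel) = 0"
    using bump_moment1[OF assms] by (rule has_bochner_integral_integral_eq)
next
  fix x :: real
  \<comment> \<open>The index of the positive block runs through the cyclic shift of 0, ..., n, a
    bijection. After reindexing, each positive block meets the reflected block of the same index,
    which makes the sum even.\<close>
  have shift: "(\<Sum>k\<le>n. g (if k = n then 0 else Suc k)) = (\<Sum>k\<le>n. g k)" for g :: "nat \<Rightarrow> real"
  proof -
    have "(\<Sum>k\<le>n. g (if k = n then 0 else Suc k)) = (\<Sum>k<n. g (Suc k)) + g 0"
      by (simp flip: lessThan_Suc_atMost)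
    also have "\<dots> = (\<Sum>k\<le>n. g k)"
      by (simp add: sum.lessThan_Suc_shift flip: lessThan_Suc_atMost del: sum.lessThan_Suc)
    finally show ?thesis .
  qed
  have "(\<Sum>k\<le>n. bump \<sigma> (if k = n then 0 else Suc k) k y) =
      (\<Sum>k\<le>n. dyadic k y + dyadic k (- y)) / 4 +
      (\<Sum>k\<le>n. weight (if k = n then 0 else Suc k) k) * normal_density 0 \<sigma> y" for y
    using shift[of "\<lambda>k. dyadic k y"]
    by (simp add: bump_def sum.distrib sum_divide_distrib[symmetric] sum_distrib_right)
  then show "(\<Sum>k\<le>n. bump \<sigma> (if k = n then 0 else Suc k) k (- x)) =
      (\<Sum>k\<le>n. bump \<sigma> (if k = n then 0 else Suc k) k x)"
    by (simp add: add.commute normal_density_def)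
qed

theorem theorem4:
  fixes q \<eta> :: real
  assumes "0 < q" and "q < 1" and "0 < \<eta>"
  shows "\<exists>(m::nat) (M :: (nat \<Rightarrow> real) measure) (W :: nat \<Rightarrow> (nat \<Rightarrow> real) \<Rightarrow> real).
    1 \<le> m \<and> prob_space M \<and> (\<forall>i\<in>{1..m}. W i \<in> borel_measurable M) \<and>
    exchangeable M {1..m} W \<and>
    has_joint_density_pos_on M {1..m} W (\<Pi>\<^sub>E i\<in>{1..m}. UNIV) \<and>
    (\<forall>i\<in>{1..m}. \<forall>j\<in>{1..m}. distr M borel (W i) = distr M borel (W j)) \<and>
    (\<forall>i\<in>{1..m}. continuous_on UNIV (cdf (distr M borel (W i)))) \<and>
    (\<forall>i\<in>{1..m}. distr M borel (\<lambda>\<omega>. - W i \<omega>) = distr M borel (W i)) \<and>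
    (\<forall>i\<in>{1..m}. integrable M (\<lambda>\<omega>. (W i \<omega>)\<^sup>2)) \<and>
    (\<forall>i\<in>{1..m}. \<forall>j\<in>{1..m}. i \<noteq> j \<longrightarrow> covariance M (W i) (W j) = 0) \<and>
    FDR M {1..m} (\<lambda>\<omega>. knockoff_rejections q {1..m} (\<lambda>i. W i \<omega>)) > 1 - \<eta> \<and>
    (\<forall>(F :: real \<Rightarrow> real) (P :: nat \<Rightarrow> (nat \<Rightarrow> real) \<Rightarrow> real).
       (\<forall>i\<in>{1..m}. F = cdf (distr M borel (W i))) \<and>
       (\<forall>i\<in>{1..m}. \<forall>\<omega>. P i \<omega> = 1 - F (W i \<omega>)) \<longrightarrow>
         exchangeable M {1..m} P \<and>
         (\<forall>i\<in>{1..m}. distr M borel (P i) = uniform_measure lborel {0<..<1}) \<and>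
         has_joint_density_pos_on M {1..m} P (\<Pi>\<^sub>E i\<in>{1..m}. {0<..<1}) \<and>
         FDR M {1..m} (\<lambda>\<omega>. mirror_rejections q {1..m} (\<lambda>i. P i \<omega>)) =
         FDR M {1..m} (\<lambda>\<omega>. knockoff_rejections q {1..m} (\<lambda>i. W i \<omega>)))"
proof -
  \<comment> \<open>With n \<eta> > 2, losing \<eta> / 2 in each good scenario and all of scenario
    \<open>n\<close> still leaves more than 1 - \<eta>.\<close>
  obtain n :: nat where n: "2 / \<eta> < real n" using reals_Archimedean2 by blast
  \<comment> \<open>Half of q / (4 * 2 ^ n), which is \<open>q\<close> times the smallest positive
    block mass among the scenarios below \<open>n\<close>.\<close>
  define \<sigma> where "\<sigma> = sqrt (q / (8 * 2 ^ n))"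
  have \<sigma>: "0 < \<sigma>" and \<sigma>2: "\<sigma>\<^sup>2 = q / (8 * 2 ^ n)" using assms(1) by (simp_all add: \<sigma>_def)
  interpret score_mixture n "\<lambda>k. bump \<sigma> (if k = n then 0 else Suc k) k"
    by (rule score_mixture_bump[OF \<sigma>])
  define adm where "adm m = {\<omega> \<in> space (\<Pi>\<^sub>M i\<in>{1..m}. borel). knockoff_admissible q {1..m} \<omega> \<noteq> {}}" for m :: nat
  have "\<forall>\<^sub>F m in sequentially. 1 - \<eta> / 2 \<le> measure (\<Pi>\<^sub>M i\<in>{1..m}. marg k) (adm m)" if "k < n" for k
    unfolding adm_def
  \<comment> \<open>The cut is where the positive block of scenario \<open>k\<close> begins and
    where, in magnitude, its negative block ends.\<close>
  proof (rule knockoff_power[OF prob_space_marg sets_marg assms(1,2), of "2 ^ Suc k"])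
    have "measure (marg k) {..- (2 ^ Suc k)} \<le> \<sigma>\<^sup>2"
      using bump_lower_tail[OF \<sigma>, of k "Suc k"] that by (simp add: marg_def)
    also have "\<dots> < q * (1 / (4 * 2 ^ n))" using assms(1) by (simp add: \<sigma>2 field_simps)
    also have "\<dots> \<le> q * (1 / (4 * 2 ^ Suc k))"
      using assms(1) that power_increasing[of "Suc k" n "2 :: real"]
      by (intro mult_left_mono divide_left_mono) auto
    also have "\<dots> \<le> q * measure (marg k) {2 ^ Suc k..}"
      using bump_upper_tail[OF \<sigma>, of "Suc k" k] assms(1) that
      by (intro mult_left_mono) (simp_all add: marg_def)
    finally show "measure (marg k) {..- (2 ^ Suc k)} < q * measure (marg k) {2 ^ Suc k..}" .
  qed (use assms in auto)
  \<comment> \<open>Finitely many scenarios, so a single \<open>m\<close> serves them all.\<close>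
  then have "\<forall>\<^sub>F m in sequentially. \<forall>k\<in>{..<n}. 1 - \<eta> / 2 \<le> measure (\<Pi>\<^sub>M i\<in>{1..m}. marg k) (adm m)"
    by (intro eventually_ball_finite) auto
  then have "\<forall>\<^sub>F m in sequentially. (\<forall>k\<in>{..<n}. 1 - \<eta> / 2 \<le> measure (\<Pi>\<^sub>M i\<in>{1..m}. marg k) (adm m)) \<and> 1 \<le> m"
    by (intro eventually_conj eventually_ge_at_top)
  then obtain m where m: "1 \<le> m"
    and power: "\<And>k. k < n \<Longrightarrow> 1 - \<eta> / 2 \<le> measure (\<Pi>\<^sub>M i\<in>{1..m}. marg k) (adm m)"
    unfolding eventually_sequentially by auto
  let ?I = "{1..m}"
  let ?M = "law ?I" and ?W = "\<lambda>(i::nat) \<omega>. \<omega> i :: real"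
  have fin: "finite ?I" by simp
  have W_meas: "?W i \<in> borel_measurable ?M" if "i \<in> ?I" for i
    using that by measurable
  have distr_W: "distr ?M borel (?W i) = \<mu>" if "i \<in> ?I" for i
    using distr_law_component[OF fin that] .
  have distr_uminus: "distr ?M borel (\<lambda>\<omega>. - ?W i \<omega>) = distr ?M borel (?W i)" if "i \<in> ?I" for i
  proof -
    have "distr ?M borel (\<lambda>\<omega>. - ?W i \<omega>) = distr (distr ?M borel (?W i)) borel uminus"
      using W_meas[OF that] by (subst distr_distr) (auto simp: o_def)
    then show ?thesis unfolding distr_W[OF that] distr_uminus_\<mu> .
  qed
  have cov: "covariance ?M (?W i) (?W j) = 0" if "i \<in> ?I" "j \<in> ?I" "i \<noteq> j" for i j
    unfolding covariance_def law_moments(2)[OF fin that(1)] law_moments(2)[OF fin that(2)]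
    using law_moments(3)[OF fin that] by simp
  have "real n * (1 - \<eta> / 2) / real (Suc n) \<le> FDR ?M ?I (\<lambda>\<omega>. knockoff_rejections q ?I (\<lambda>i. ?W i \<omega>))"
    using power unfolding adm_def by (intro FDR_knockoff_ge fin assms(2))
  moreover have "1 - \<eta> < real n * (1 - \<eta> / 2) / real (Suc n)"
  proof -
    have "2 < real n * \<eta>" using n assms(3) by (simp add: field_simps)
    then show ?thesis using assms(3) by (simp add: field_simps)
  qed
  ultimately have FDR_gt: "FDR ?M ?I (\<lambda>\<omega>. knockoff_rejections q ?I (\<lambda>i. ?W i \<omega>)) > 1 - \<eta>"
    by linarith
  have P_part: "exchangeable ?M ?I P \<and>
      (\<forall>i\<in>?I. distr ?M borel (P i) = uniform_measure lborel {0<..<1}) \<and>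
      has_joint_density_pos_on ?M ?I P (\<Pi>\<^sub>E i\<in>?I. {0<..<1}) \<and>
      FDR ?M ?I (\<lambda>\<omega>. mirror_rejections q ?I (\<lambda>i. P i \<omega>)) =
      FDR ?M ?I (\<lambda>\<omega>. knockoff_rejections q ?I (\<lambda>i. ?W i \<omega>))"
    if F: "\<forall>i\<in>?I. F = cdf (distr ?M borel (?W i))" and P: "\<forall>i\<in>?I. \<forall>\<omega>. P i \<omega> = 1 - F (?W i \<omega>)"
    for F :: "real \<Rightarrow> real" and P :: "nat \<Rightarrow> (nat \<Rightarrow> real) \<Rightarrow> real"
  proof (intro conjI ballI)
    \<comment> \<open>\<open>F\<close> is constrained only through indices in the range; 1 <= m
      supplies one and so identifies \<open>F\<close> with the cdf of \<open>\<mu>\<close>.\<close>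
    have one: "1 \<in> ?I" using m by simp
    have "F = cdf (distr ?M borel (?W 1))" using F one by (rule bspec)
    then have "F = cdf \<mu>" unfolding distr_W[OF one] .
    then have P: "P i \<omega> = pval (\<omega> i)" if "i \<in> ?I" for i \<omega>
      using P that by (simp add: pval_def)
    show "exchangeable ?M ?I P"
      by (rule exchangeable_compose[OF W_meas pval_measurable exchangeable_law[OF fin]]) (simp_all add: P)
    show "distr ?M borel (P i) = uniform_measure lborel {0<..<1}" if i: "i \<in> ?I" for i
    proof -
      have "distr ?M borel (P i) = distr (distr ?M borel (?W i)) borel pval"
        using W_meas[OF i] by (subst distr_distr) (auto simp: o_def P[OF i] intro!: distr_cong)
      then show ?thesis unfolding distr_W[OF i] distr_pval .
    qed
    have "(\<lambda>\<omega>. \<lambda>i\<in>?I. P i \<omega>) = (\<lambda>\<omega>. \<lambda>i\<in>?I. pval (\<omega> i))"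
      by (auto simp: fun_eq_iff P)
    then show "has_joint_density_pos_on ?M ?I P (\<Pi>\<^sub>E i\<in>?I. {0<..<1})"
      using joint_density_pval[OF fin] unfolding has_joint_density_pos_on_def by simp
    show "FDR ?M ?I (\<lambda>\<omega>. mirror_rejections q ?I (\<lambda>i. P i \<omega>)) =
        FDR ?M ?I (\<lambda>\<omega>. knockoff_rejections q ?I (\<lambda>i. ?W i \<omega>))"
      by (rule FDR_mirror[where p = P, OF fin assms(2) P])
  qed
  show ?thesis
  proof (rule exI[of _ m], rule exI[of _ ?M], rule exI[of _ ?W], intro conjI)
    show "1 \<le> m" by (rule m)
    show "prob_space ?M" by (rule prob_space_law[OF fin])
    show "\<forall>i\<in>?I. ?W i \<in> borel_measurable ?M" using W_meas by (rule ballI)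
    show "exchangeable ?M ?I ?W" by (rule exchangeable_law[OF fin])
    show "has_joint_density_pos_on ?M ?I ?W (\<Pi>\<^sub>E i\<in>?I. UNIV)" by (rule joint_density_law[OF fin])
    show "\<forall>i\<in>?I. \<forall>j\<in>?I. distr ?M borel (?W i) = distr ?M borel (?W j)"
    proof (intro ballI)
      fix i j assume i: "i \<in> ?I" and j: "j \<in> ?I"
      show "distr ?M borel (?W i) = distr ?M borel (?W j)" unfolding distr_W[OF i] distr_W[OF j] ..
    qed
    show "\<forall>i\<in>?I. continuous_on UNIV (cdf (distr ?M borel (?W i)))"
    proof
      fix i assume i: "i \<in> ?I"
      show "continuous_on UNIV (cdf (distr ?M borel (?W i)))"
        unfolding distr_W[OF i] using isCont_cdf_\<mu> by (simp add: continuous_on_eq_continuous_at)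
    qed
    show "\<forall>i\<in>?I. distr ?M borel (\<lambda>\<omega>. - ?W i \<omega>) = distr ?M borel (?W i)" using distr_uminus by (rule ballI)
    show "\<forall>i\<in>?I. integrable ?M (\<lambda>\<omega>. (?W i \<omega>)\<^sup>2)" using law_moments(1)[OF fin] by (rule ballI)
    show "\<forall>i\<in>?I. \<forall>j\<in>?I. i \<noteq> j \<longrightarrow> covariance ?M (?W i) (?W j) = 0" by (intro ballI impI cov)
    show "FDR ?M ?I (\<lambda>\<omega>. knockoff_rejections q ?I (\<lambda>i. ?W i \<omega>)) > 1 - \<eta>" by (rule FDR_gt)
  qed (intro allI impI, elim conjE, rule P_part, assumption+)
qed

end
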